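(* For stationary planar Boolean models with smooth convex grains, the surface tensor densities $\overline{\Phi}_1^{\,0,s}(X)$, $s\in\mathbb{N}_0$, determine $\gamma\,\mathbb{E}[r(Z_0,u(\varphi))]$ for almost all $\varphi\in[0,2\pi]$. That is: let $\gamma,\gamma'>0$ and let $\mathbb{Q},\mathbb{Q}'$ be grain distributions on $\mathcal{K}_0$ concentrated on $\mathcal{K}_0\cap C^2_+$ (in $\mathbb{R}^2$), with associated particle processes $X$ (for $\gamma,\mathbb{Q}$) and $X'$ (for $\gamma',\mathbb{Q}'$). If $\overline{\Phi}_1^{\,0,s}(X)=\overline{\Phi}_1^{\,0,s}(X')$ for all $s\in\mathbb{N}_0$, then $$\gamma\int_{\mathcal{K}_0}r(K,u(\varphi))\,\mathbb{Q}(dK)=\gamma'\int_{\mathcal{K}_0}r(K,u(\varphi))\,\mathbb{Q}'(dK)\qquad\text{for almost all }\varphi\in[0,2\pi].$$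
   Context: $\mathcal{K}_0$ is the set of convex bodies (nonempty compact convex sets) in $\mathbb{R}^2$ whose smallest enclosing disc is centered at $0$. $C^2_+$ denotes the convex bodies whose boundary is of class $C^2$ with everywhere positive curvature. For $K\in C^2_+$ and $u\in S^1$, $r(K,u)$ is the radius of curvature of $\partial K$ at the boundary point with outer unit normal $u$. $u(\varphi)=(\cos\varphi,\sin\varphi)$. A grain distribution is a probability measure $\mathbb{Q}$ on $\mathcal{K}_0$ with $\int\lambda(K+B^2)\,\mathbb{Q}(dK)<\infty$, where $B^2$ is the unit disc and $\lambda$ Lebesgue measure. The particle process $X$ with intensity $\gamma$ and grain distribution $\mathbb{Q}$ is the Poisson process of convex bodies with intensity measure $\gamma\int_{\mathbb{R}^2}\int_{\mathcal{K}_0}\mathbf{1}\{K+x\in\cdot\}\,\mathbb{Q}(dK)\,dx$; the associated Boolean model is the union of its particles. The typical grain $Z_0$ is a random convex body with distribution $\mathbb{Q}$, so $\gamma\,\mathbb{E}[r(Z_0,u)]=\gamma\int r(K,u)\,\mathbb{Q}(dK)$. With $\omega_m$ the surface area of the unit sphere in $\mathbb{R}^m$, the surface tensor of a convex body $K\subset\mathbb{R}^2$ is $\Phi_1^{0,s}(K)=\frac{1}{s!}\frac{\omega_1}{\omega_{1+s}}\int u^s\,\Lambda_1(K;d(x,u))$, where $u^s$ is the $s$-fold symmetric tensor power, and $\Lambda_1(K;\cdot)$ is the first support measure of $K$ on $\mathbb{R}^2\times S^1$, determined together with $\Lambda_0(K;\cdot)$ by the local Steiner formula $\lambda(\{x\in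 (K+\epsilon B^2)\setminus K:(p(K,x),u(K,x))\in\eta\})=2\epsilon\Lambda_1(K;\eta)+\pi\epsilon^2\Lambda_0(K;\eta)$ for $\epsilon>0$ and Borel $\eta$ ($p(K,x)$ the nearest point of $K$ to $x$, $u(K,x)=(x-p(K,x))/\|x-p(K,x)\|$). The density is $\overline{\Phi}_1^{\,0,s}(X)=\gamma\int_{\mathcal{K}_0}\Phi_1^{0,s}(K)\,\mathbb{Q}(dK)$ (coordinatewise). *)

theory Defs
  imports "HOL-Probability.Probability"
begin

subsection \<open>Convex bodies in the plane\<close>

definition convex_bodies :: "(real^2) set set" where
  "convex_bodies = {K. K \<noteq> {} \<and> compact K \<and> convex K}"

text \<open>For sets, \<open>+\<close> is the Minkowski sum (theory Set_Algebras), so \<open>K + cball 0 \<epsilon>\<close>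
  is \<open>K + \<epsilon> B\<^sup>2\<close>.\<close>

definition hausdorff_dist :: "(real^2) set \<Rightarrow> (real^2) set \<Rightarrow> real" where
  "hausdorff_dist K L = Inf {\<epsilon>. 0 \<le> \<epsilon> \<and> K \<subseteq> L + cball 0 \<epsilon> \<and> L \<subseteq> K + cball 0 \<epsilon>}"

text \<open>Convex bodies with the Borel sets of the Hausdorff metric.\<close>

definition convex_body_borel :: "(real^2) set measure" where
  "convex_body_borel = sigma convex_bodies
     {U. U \<subseteq> convex_bodies \<and>
         (\<forall>K\<in>U. \<exists>e>0. \<forall>L\<in>convex_bodies. hausdorff_dist K L < e \<longrightarrow> L \<in> U)}"

definition centered_bodies :: "(real^2) set set" where
  "centered_bodies = {K \<in> convex_bodies.
     \<exists>r. K \<subseteq> cball 0 r \<and> (\<forall>c \<rho>. K \<subseteq> cball c \<rho> \<longrightarrow> r \<le> \<rho>)}"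


subsection \<open>Boundaries of class \<open>C\<^sup>2\<close> and curvature\<close>

text \<open>\<open>C2_chart S p c c1 c2\<close>: near \<open>p\<close> the set \<open>S\<close> is a regular curve of class \<open>C\<^sup>2\<close>, with
  local parametrization \<open>c\<close> sending \<open>0\<close> to \<open>p\<close> and derivatives \<open>c1 = c'\<close>, \<open>c2 = c''\<close>.\<close>

definition C2_chart ::
    "(real^2) set \<Rightarrow> real^2 \<Rightarrow> (real \<Rightarrow> real^2) \<Rightarrow> (real \<Rightarrow> real^2) \<Rightarrow> (real \<Rightarrow> real^2) \<Rightarrow> bool" where
  "C2_chart S p c c1 c2 \<longleftrightarrow>
     c 0 = p \<and>
     (\<exists>U g. open U \<and> p \<in> U \<and> homeomorphism {-1<..<1} (S \<inter> U) c g) \<and>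
     (\<forall>t\<in>{-1<..<1}. (c has_vector_derivative c1 t) (at t) \<and>
                     (c1 has_vector_derivative c2 t) (at t) \<and> c1 t \<noteq> 0) \<and>
     continuous_on {-1<..<1} c2"

definition C2_boundary :: "(real^2) set \<Rightarrow> bool" where
  "C2_boundary K \<longleftrightarrow> (\<forall>p\<in>frontier K. \<exists>c c1 c2. C2_chart (frontier K) p c c1 c2)"

text \<open>The value does not depend on the chart. The absolute value removes the dependence on the
  orientation of the chart; for a convex body it is the curvature with respect to the inner
  normal, which is nonnegative.\<close>

definition curvature :: "(real^2) set \<Rightarrow> real^2 \<Rightarrow> real" where
  "curvature K p = (SOME \<kappa>. \<exists>c c1 c2. C2_chart (frontier K) p c c1 c2 \<and>
     \<kappa> = \<bar>c1 0 $ 1 * c2 0 $ 2 - c1 0 $ 2 * c2 0 $ 1\<bar> / norm (c1 0) ^ 3)"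

definition C2_plus :: "(real^2) set set" where
  "C2_plus = {K \<in> convex_bodies. C2_boundary K \<and> (\<forall>p\<in>frontier K. 0 < curvature K p)}"

definition outer_normal_at :: "(real^2) set \<Rightarrow> real^2 \<Rightarrow> real^2 \<Rightarrow> bool" where
  "outer_normal_at K p u \<longleftrightarrow> p \<in> frontier K \<and> norm u = 1 \<and> (\<forall>y\<in>K. (y - p) \<bullet> u \<le> 0)"

definition radius_of_curvature :: "(real^2) set \<Rightarrow> real^2 \<Rightarrow> real" where
  "radius_of_curvature K u = 1 / curvature K (THE p. outer_normal_at K p u)"

definition unit_vec :: "real \<Rightarrow> real^2" where
  "unit_vec \<phi> = vector [cos \<phi>, sin \<phi>]"


subsection \<open>Support measures and surface tensors\<close>

text \<open>\<open>\<Lambda>0\<close> and \<open>\<Lambda>1\<close> are measures on the Borel sets of the product of the plane and the unit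
  circle. The vector \<open>sgn (x - closest_point K x)\<close> is
  \<open>(x - closest_point K x) / norm (x - closest_point K x)\<close>.\<close>

definition local_Steiner ::
    "(real^2) set \<Rightarrow> ((real^2) \<times> (real^2)) measure \<Rightarrow> ((real^2) \<times> (real^2)) measure \<Rightarrow> bool" where
  "local_Steiner K \<Lambda>0 \<Lambda>1 \<longleftrightarrow>
     sets \<Lambda>0 = sets (restrict_space borel (UNIV \<times> sphere 0 1)) \<and>
     sets \<Lambda>1 = sets (restrict_space borel (UNIV \<times> sphere 0 1)) \<and>
     (\<forall>\<epsilon>>0. \<forall>\<eta>\<in>sets (restrict_space borel (UNIV \<times> sphere 0 1)).
        emeasure lborel {x \<in> (K + cball 0 \<epsilon>) - K.
            (closest_point K x, sgn (x - closest_point K x)) \<in> \<eta>}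
        = ennreal (2 * \<epsilon>) * emeasure \<Lambda>1 \<eta> + ennreal (pi * \<epsilon>\<^sup>2) * emeasure \<Lambda>0 \<eta>)"

definition support_measure1 :: "(real^2) set \<Rightarrow> ((real^2) \<times> (real^2)) measure" where
  "support_measure1 K = (THE \<Lambda>1. \<exists>\<Lambda>0. local_Steiner K \<Lambda>0 \<Lambda>1)"

definition sphere_surface :: "nat \<Rightarrow> real" where
  "sphere_surface m = 2 * pi powr (real m / 2) / Gamma (real m / 2)"

text \<open>Tensors of rank \<open>s\<close> on the plane are given by their coordinates with respect to the
  standard basis, indexed by lists of indices of length \<open>s\<close>; other lists get the value \<open>0\<close>.\<close>

type_synonym tensor = "2 list \<Rightarrow> real"

definition tensor_power :: "nat \<Rightarrow> real^2 \<Rightarrow> tensor" where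
  "tensor_power s u = (\<lambda>is. if length is = s then (\<Prod>i\<leftarrow>is. u $ i) else 0)"

definition surface_tensor :: "nat \<Rightarrow> (real^2) set \<Rightarrow> tensor" where
  "surface_tensor s K = (\<lambda>is. 1 / fact s * (sphere_surface 1 / sphere_surface (1 + s)) *
     (\<integral>z. tensor_power s (snd z) is \<partial>support_measure1 K))"


subsection \<open>Grain distributions and particle processes\<close>

definition grain_distribution :: "(real^2) set measure \<Rightarrow> bool" where
  "grain_distribution Q \<longleftrightarrow> prob_space Q \<and>
     sets Q = sets (restrict_space convex_body_borel centered_bodies) \<and>
     (\<integral>\<^sup>+K. emeasure lborel (K + cball 0 1) \<partial>Q) < \<infinity>"

definition particle_intensity ::
    "real \<Rightarrow> (real^2) set measure \<Rightarrow> (real^2) set set \<Rightarrow> ennreal" where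
  "particle_intensity \<gamma> Q A =
     ennreal \<gamma> * (\<integral>\<^sup>+x. (\<integral>\<^sup>+K. indicator A ((+) x ` K) \<partial>Q) \<partial>lborel)"

text \<open>The intensity measure has no atoms, so the Poisson process is almost surely simple and is
  represented by its random set of particles, defined on a probability space \<open>M\<close>.\<close>

definition particle_count :: "('w \<Rightarrow> (real^2) set set) \<Rightarrow> (real^2) set set \<Rightarrow> 'w \<Rightarrow> ennreal" where
  "particle_count X A \<omega> = emeasure (count_space UNIV) (X \<omega> \<inter> A)"

definition poisson_particle_process ::
    "'w measure \<Rightarrow> ('w \<Rightarrow> (real^2) set set) \<Rightarrow> real \<Rightarrow> (real^2) set measure \<Rightarrow> bool" where
  "poisson_particle_process M X \<gamma> Q \<longleftrightarrow>
     prob_space M \<and>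
     (\<forall>\<omega>\<in>space M. X \<omega> \<subseteq> convex_bodies) \<and>
     (\<forall>A\<in>sets convex_body_borel.
        particle_count X A \<in> borel_measurable M \<and>
        (if particle_intensity \<gamma> Q A = \<infinity>
         then AE \<omega> in M. particle_count X A \<omega> = \<infinity>
         else \<forall>k. measure M {\<omega> \<in> space M. particle_count X A \<omega> = of_nat k} =
                enn2real (particle_intensity \<gamma> Q A) ^ k / fact k
                  * exp (- enn2real (particle_intensity \<gamma> Q A)))) \<and>
     (\<forall>(A :: nat \<Rightarrow> (real^2) set set) n.
        (\<forall>i<n. A i \<in> sets convex_body_borel) \<longrightarrow> disjoint_family_on A {..<n} \<longrightarrow>
        prob_space.indep_vars M (\<lambda>_. borel) (\<lambda>i. particle_count X (A i)) {..<n})"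

text \<open>Integrating with respect to the completion of \<open>Q\<close> agrees with integrating with respect to
  \<open>Q\<close> for \<open>Q\<close>-measurable integrands.\<close>

definition surface_tensor_density :: "real \<Rightarrow> (real^2) set measure \<Rightarrow> nat \<Rightarrow> tensor" where
  "surface_tensor_density \<gamma> Q s = (\<lambda>is. \<gamma> * (\<integral>K. surface_tensor s K is \<partial>completion Q))"

text \<open>The mean radius of curvature may be infinite for exceptional directions, hence the
  extended nonnegative integral.\<close>

definition mean_radius :: "real \<Rightarrow> (real^2) set measure \<Rightarrow> real^2 \<Rightarrow> ennreal" where
  "mean_radius \<gamma> Q u = ennreal \<gamma> * (\<integral>\<^sup>+K. ennreal (radius_of_curvature K u) \<partial>Q)"

end

(*
  Near a boundary point with outer normal u(phi) the gradient equation of a C^2 chart shows that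
  the support point p(phi) of a body K in C^2_+ is differentiable with p' = r u', r the radius of
  curvature. Hence (phi, t) -> p(phi) + t u(phi) parametrizes the complement of K near K with
  Jacobian r + t, and the local Steiner formula identifies the first support measure of K as the
  image of r/2 dphi. By Fubini the tensor densities are, up to positive constants, the moments of
  the image of gamma E[r(Z_0, u(phi))] dphi on the circle under products of coordinates, and these
  moments determine a finite measure on the circle by Stone-Weierstrass.
*)
theory Submission
  imports Defs
begin

subsection \<open>The moving frame\<close>

text \<open>\<open>curvature\<close> takes its value by \<open>SOME\<close> from charts at a single
  point, so neither regularity of the radius in the angle nor measurability in the body is visible
  from the definition. In the angle, the radius is recovered from the derivative of
  \<open>support_point K \<phi> \<bullet> unit_tan \<phi>\<close>, a limit of difference quotients
  of a continuous function; the area formula for injective differentiable maps asks for no more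
  regularity. In the body, the same quantity is h'' + h for the support function h, and limits of
  difference quotients of h are jointly measurable in body and angle, also off
  \<open>C2_plus\<close>. The integrability condition in \<open>grain_distribution\<close> makes all
  moments finite: the integral of the radius over the circle is at most the area of
  \<open>K + cball 0 1\<close>. The result holds almost everywhere because it compares two densities
  of the same measure on the angles.\<close>

definition unit_tan :: "real \<Rightarrow> real^2" where
  "unit_tan \<phi> = vector [- sin \<phi>, cos \<phi>]"

lemma vec2_eq_iff: "(x::real^2) = y \<longleftrightarrow> x $ 1 = y $ 1 \<and> x $ 2 = y $ 2"
  by (simp add: vec_eq_iff forall_2)

lemma inner_vec2: "(x::real^2) \<bullet> y = x $ 1 * y $ 1 + x $ 2 * y $ 2"
  by (simp add: inner_vec_def sum_2)

lemma unit_vec_nth [simp]: "unit_vec \<phi> $ 1 = cos \<phi>" "unit_vec \<phi> $ 2 = sin \<phi>"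
  by (simp_all add: unit_vec_def)

lemma unit_tan_nth [simp]: "unit_tan \<phi> $ 1 = - sin \<phi>" "unit_tan \<phi> $ 2 = cos \<phi>"
  by (simp_all add: unit_tan_def)

lemma frame_inner [simp]:
  "unit_vec \<phi> \<bullet> unit_vec \<phi> = 1" "unit_tan \<phi> \<bullet> unit_tan \<phi> = 1"
  "unit_vec \<phi> \<bullet> unit_tan \<phi> = 0" "unit_tan \<phi> \<bullet> unit_vec \<phi> = 0"
  by (simp_all add: inner_vec2 flip: power2_eq_square)

lemma norm_frame [simp]: "norm (unit_vec \<phi>) = 1" "norm (unit_tan \<phi>) = 1"
  by (simp_all add: norm_eq_sqrt_inner)

lemma frame_expansion:
  "x = (x \<bullet> unit_vec \<phi>) *\<^sub>R unit_vec \<phi> + (x \<bullet> unit_tan \<phi>) *\<^sub>R unit_tan \<phi>"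
proof -
  have *: "a = cos \<phi> * (cos \<phi> * a) + sin \<phi> * (sin \<phi> * a)" for a
    using sin_cos_squared_add2[of \<phi>] by (metis distrib_right mult.assoc mult_1 power2_eq_square)
  show ?thesis
    by (simp add: vec2_eq_iff inner_vec2 algebra_simps) (metis *)
qed

lemma norm_eq_1_unit_vecE:
  assumes "norm (x::real^2) = 1"
  obtains \<phi> where "\<phi> \<in> {0..<2*pi}" "x = unit_vec \<phi>"
proof -
  have "(x$1)\<^sup>2 + (x$2)\<^sup>2 = 1"
    using assms by (simp add: norm_eq_sqrt_inner inner_vec2 power2_eq_square)
  then obtain t where "0 \<le> t" "t < 2*pi" "x$1 = cos t" "x$2 = sin t"
    by (rule sincos_total_2pi)
  then show thesis
    by (intro that[of t]) (auto simp: vec2_eq_iff)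
qed

lemma inj_on_unit_vec: "inj_on unit_vec {0..<2*pi}"
proof (rule inj_onI)
  fix x y assume *: "x \<in> {0..<2*pi}" "y \<in> {0..<2*pi}" "unit_vec x = unit_vec y"
  then have "cos x = cos y" "sin x = sin y"
    by (auto simp: vec2_eq_iff)
  then have "sin x = sin y \<and> cos x = cos y" by simp
  then obtain n where n: "x = y + 2 * pi * real_of_int n"
    unfolding sin_cos_eq_iff by auto
  have "\<bar>2 * pi * real_of_int n\<bar> < 2 * pi" using * n by auto
  then have "\<bar>real_of_int n\<bar> < 1"
    by (simp add: abs_mult)
  then show "x = y" using n by simp
qed

lemma has_vector_derivative_unit_vec [derivative_intros]:
  "(unit_vec has_vector_derivative unit_tan \<phi>) (at \<phi> within S)"
proof -
  have "unit_vec = (\<lambda>\<phi>. cos \<phi> *\<^sub>R vector [1, 0] + sin \<phi> *\<^sub>R vector [0, 1])"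
    by (auto simp: vec2_eq_iff)
  moreover have "((\<lambda>\<phi>. cos \<phi> *\<^sub>R vector [1, 0] + sin \<phi> *\<^sub>R vector [0, 1] :: real^2)
      has_vector_derivative unit_tan \<phi>) (at \<phi> within S)"
    by (auto intro!: derivative_eq_intros simp: vec2_eq_iff)
  ultimately show ?thesis by simp
qed

lemma has_vector_derivative_unit_tan [derivative_intros]:
  "(unit_tan has_vector_derivative - unit_vec \<phi>) (at \<phi> within S)"
proof -
  have "unit_tan = (\<lambda>\<phi>. (- sin \<phi>) *\<^sub>R vector [1, 0] + cos \<phi> *\<^sub>R vector [0, 1])"
    by (auto simp: vec2_eq_iff)
  moreover have "((\<lambda>\<phi>. (- sin \<phi>) *\<^sub>R vector [1, 0] + cos \<phi> *\<^sub>R vector [0, 1] :: real^2)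
      has_vector_derivative - unit_vec \<phi>) (at \<phi> within S)"
    by (auto intro!: derivative_eq_intros simp: vec2_eq_iff)
  ultimately show ?thesis by simp
qed

lemma continuous_on_unit_vec [continuous_intros]:
  "continuous_on S f \<Longrightarrow> continuous_on S (\<lambda>x. unit_vec (f x))"
  by (rule continuous_on_compose2[of UNIV])
     (auto intro!: continuous_at_imp_continuous_on has_vector_derivative_continuous has_vector_derivative_unit_vec)

lemma continuous_on_unit_tan [continuous_intros]:
  "continuous_on S f \<Longrightarrow> continuous_on S (\<lambda>x. unit_tan (f x))"
  by (rule continuous_on_compose2[of UNIV])
     (auto intro!: continuous_at_imp_continuous_on has_vector_derivative_continuous has_vector_derivative_unit_tan)

section \<open>Slopes and the linear factor of a differentiable curve\<close>

lemma has_vector_derivative_iff_slope: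
  fixes f :: "real \<Rightarrow> 'a::real_normed_vector"
  shows "(f has_vector_derivative D) (at x) \<longleftrightarrow> ((\<lambda>y. (f y - f x) /\<^sub>R (y - x)) \<longlongrightarrow> D) (at x)"
proof -
  let ?e = "\<lambda>y. (f y - f x - (y - x) *\<^sub>R D) /\<^sub>R norm (y - x)"
  have "\<forall>\<^sub>F y in at x. norm (?e y) = norm ((f y - f x) /\<^sub>R (y - x) - D)"
  proof (rule eventually_mono[OF eventually_neq_at_within[of x]])
    fix y assume "y \<noteq> x"
    then have "(f y - f x) /\<^sub>R (y - x) - D = (f y - f x - (y - x) *\<^sub>R D) /\<^sub>R (y - x)"
      by (simp add: scaleR_diff_right)
    then show "norm (?e y) = norm ((f y - f x) /\<^sub>R (y - x) - D)" by simp
  qed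
  then have "((\<lambda>y. norm (?e y)) \<longlongrightarrow> 0) (at x) \<longleftrightarrow>
      ((\<lambda>y. norm ((f y - f x) /\<^sub>R (y - x) - D)) \<longlongrightarrow> 0) (at x)"
    by (rule tendsto_cong)
  then have "(?e \<longlongrightarrow> 0) (at x) \<longleftrightarrow> ((\<lambda>y. (f y - f x) /\<^sub>R (y - x)) \<longlongrightarrow> D) (at x)"
    by (simp only: tendsto_norm_zero_iff LIM_zero_iff)
  then show ?thesis
    by (simp add: has_vector_derivative_def has_derivative_def Lim_ident_at bounded_linear_scaleR_left)
qed

text \<open>With the slope completed by \<open>D\<close> at \<open>y = x\<close>, a first-order
  expansion becomes an exact equation, which can be divided by its linear factor before passing to
  the limit.\<close>

lemma vector_Caratheodory:
  fixes f :: "real \<Rightarrow> 'a::real_normed_vector"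
  assumes "(f has_vector_derivative D) (at x)"
  obtains q where "\<And>y. f y = f x + (y - x) *\<^sub>R q y" "isCont q x" "q x = D"
proof -
  define q where "q y = (if y = x then D else (f y - f x) /\<^sub>R (y - x))" for y
  have "(q \<longlongrightarrow> D) (at x)"
    by (rule Lim_transform_eventually[OF assms[unfolded has_vector_derivative_iff_slope]])
       (auto simp: q_def eventually_at_filter)
  then have "isCont q x" by (simp add: isCont_def q_def)
  moreover have "f y = f x + (y - x) *\<^sub>R q y" for y
    by (simp add: q_def)
  ultimately show thesis by (intro that[of q]) (auto simp: q_def)
qed

subsection \<open>Support points of bodies with positive curvature\<close>

lemma convex_bodiesD: "K \<in> convex_bodies \<Longrightarrow> K \<noteq> {} \<and> compact K \<and> convex K \<and> closed K \<and> bounded K"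
  by (simp add: convex_bodies_def compact_imp_closed compact_imp_bounded)

text \<open>From an interior point a small step along \<open>u\<close> would stay in
  \<open>K\<close> and violate the normal inequality, so the inequality forces \<open>p\<close> onto
  the frontier.\<close>

lemma outer_normal_at_iff:
  assumes "closed K"
  shows "outer_normal_at K p u \<longleftrightarrow> p \<in> K \<and> norm u = 1 \<and> (\<forall>y\<in>K. (y - p) \<bullet> u \<le> 0)"
proof -
  have "p \<in> frontier K" if "p \<in> K" "norm u = 1" "\<forall>y\<in>K. (y - p) \<bullet> u \<le> 0"
  proof -
    have "p \<notin> interior K"
    proof
      assume "p \<in> interior K"
      then obtain e where "e > 0" "cball p e \<subseteq> K" by (meson mem_interior_cball)
      moreover have "p + e *\<^sub>R u \<in> cball p e"
        using that \<open>e > 0\<close> by (simp add: dist_norm)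
      ultimately have "(e *\<^sub>R u) \<bullet> u \<le> 0" using that(3) by (metis add_diff_cancel_left' subsetD)
      then have "e * (u \<bullet> u) \<le> 0" by simp
      moreover have "u \<bullet> u = 1" using that(2) by (simp add: norm_eq_sqrt_inner)
      ultimately show False using \<open>e > 0\<close> by simp
    qed
    then show ?thesis using that assms by (simp add: frontier_def)
  qed
  then show ?thesis
    using assms frontier_subset_closed by (auto simp: outer_normal_at_def)
qed

lemma outer_normal_at_exists:
  assumes "K \<in> convex_bodies"
  obtains p where "outer_normal_at K p (unit_vec \<phi>)"
proof -
  have "continuous_on K (\<lambda>y. y \<bullet> unit_vec \<phi>)" by (intro continuous_intros)
  then obtain p where "p \<in> K" "\<forall>y\<in>K. y \<bullet> unit_vec \<phi> \<le> p \<bullet> unit_vec \<phi>"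
    using continuous_attains_sup[of K] convex_bodiesD[OF assms] by metis
  then show thesis
    using that[of p] by (auto simp: outer_normal_at_iff convex_bodiesD[OF assms] inner_diff_left)
qed

text \<open>The parameter 0 maximises the height \<open>c t \<bullet> unit_vec \<phi>\<close>. The
  first-order condition makes \<open>c1 0\<close> tangential; the second-order condition recovers
  the sign of the normal part of \<open>c2 0\<close>, which the absolute value in
  \<open>curvature\<close> hides.\<close>

lemma chart_at_support_point:
  assumes K: "K \<in> C2_plus" and p: "outer_normal_at K p (unit_vec \<phi>)"
  obtains c c1 c2 U g a where
    "C2_chart (frontier K) p c c1 c2"
    "open U" "p \<in> U" "homeomorphism {-1<..<1} (frontier K \<inter> U) c g"
    "a \<noteq> 0" "c1 0 = a *\<^sub>R unit_tan \<phi>" "c2 0 \<bullet> unit_vec \<phi> = - curvature K p * a\<^sup>2"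
proof -
  have Kb: "K \<in> convex_bodies" and pf: "p \<in> frontier K"
    using assms by (auto simp: C2_plus_def outer_normal_at_def)
  define u where "u = unit_vec \<phi>"
  have "\<exists>\<kappa> c c1 c2. C2_chart (frontier K) p c c1 c2 \<and>
     \<kappa> = \<bar>c1 0 $ 1 * c2 0 $ 2 - c1 0 $ 2 * c2 0 $ 1\<bar> / norm (c1 0) ^ 3"
    using K pf unfolding C2_plus_def C2_boundary_def by blast
  \<comment> \<open>The chart is the one realising the value picked by \<open>SOME\<close>, so the
    curvature formula holds for it by choice.\<close>
  then have "\<exists>c c1 c2. C2_chart (frontier K) p c c1 c2 \<and>
     curvature K p = \<bar>c1 0 $ 1 * c2 0 $ 2 - c1 0 $ 2 * c2 0 $ 1\<bar> / norm (c1 0) ^ 3"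
    unfolding curvature_def by (rule someI_ex)
  then obtain c c1 c2 where c: "C2_chart (frontier K) p c c1 c2"
    and kap: "curvature K p = \<bar>c1 0 $ 1 * c2 0 $ 2 - c1 0 $ 2 * c2 0 $ 1\<bar> / norm (c1 0) ^ 3"
    by blast
  obtain U g where U: "open U" "p \<in> U" and hom: "homeomorphism {-1<..<1} (frontier K \<inter> U) c g"
    and c0: "c 0 = p"
    and der: "\<And>t. t\<in>{-1<..<1} \<Longrightarrow> (c has_vector_derivative c1 t) (at t)"
       "\<And>t. t\<in>{-1<..<1} \<Longrightarrow> (c1 has_vector_derivative c2 t) (at t)"
       "\<And>t. t\<in>{-1<..<1} \<Longrightarrow> c1 t \<noteq> 0"
    using c unfolding C2_chart_def by blast
  have cK: "c t \<in> K" if "t \<in> {-1<..<1}" for t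
    using homeomorphism_image1[OF hom] that frontier_subset_closed convex_bodiesD[OF Kb] by blast
  define f where "f t = c t \<bullet> u" for t
  have f_le: "f t \<le> f 0" if "t \<in> {-1<..<1}" for t
    using cK[OF that] p by (auto simp: f_def c0 outer_normal_at_def u_def inner_diff_left)
  have f_der: "(f has_real_derivative c1 t \<bullet> u) (at t)" if "t \<in> {-1<..<1}" for t
    unfolding f_def has_real_derivative_iff_has_vector_derivative
    by (rule bounded_linear.has_vector_derivative[OF bounded_linear_inner_left der(1)[OF that]])
  have c1u: "c1 0 \<bullet> u = 0"
    by (rule DERIV_local_max[OF f_der[of 0], of 1]) (use f_le in \<open>auto simp: abs_less_iff\<close>)
  define a where "a = c1 0 \<bullet> unit_tan \<phi>"
  have c1a: "c1 0 = a *\<^sub>R unit_tan \<phi>"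
    using frame_expansion[of "c1 0" \<phi>] c1u by (simp add: a_def u_def)
  have "a \<noteq> 0" using der(3)[of 0] c1a by auto
  have "c1 0 $ 1 * c2 0 $ 2 - c1 0 $ 2 * c2 0 $ 1 = - a * (c2 0 \<bullet> u)"
    by (simp add: c1a inner_vec2 u_def algebra_simps)
  then have "curvature K p = \<bar>a\<bar> * \<bar>c2 0 \<bullet> u\<bar> / \<bar>a\<bar> ^ 3"
    by (simp add: kap c1a abs_mult)
  also have "\<dots> = \<bar>c2 0 \<bullet> u\<bar> / a\<^sup>2"
    using \<open>a \<noteq> 0\<close> by (simp add: power3_eq_cube power2_eq_square divide_simps)
  finally have kap': "\<bar>c2 0 \<bullet> u\<bar> = curvature K p * a\<^sup>2"
    using \<open>a \<noteq> 0\<close> by (simp add: field_simps)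
  \<comment> \<open>Otherwise \<open>c1 z \<bullet> u = z * (q z \<bullet> u)\<close> would be
    positive for small \<open>z > 0\<close>, and the mean value theorem would lift
    \<open>f s\<close> above the maximum \<open>f 0\<close>.\<close>
  have "c2 0 \<bullet> u \<le> 0"
  proof (rule ccontr)
    assume pos: "\<not> c2 0 \<bullet> u \<le> 0"
    obtain q where q: "\<And>t. c1 t = c1 0 + (t - 0) *\<^sub>R q t" "isCont q 0" "q 0 = c2 0"
      using vector_Caratheodory[OF der(2)[of 0]] by auto
    have "isCont (\<lambda>t. q t \<bullet> u) 0" using q(2) by (intro continuous_intros)
    then have "((\<lambda>t. q t \<bullet> u) \<longlongrightarrow> c2 0 \<bullet> u) (at 0)"
      unfolding isCont_def q(3) .
    then have "\<forall>\<^sub>F t in at 0. q t \<bullet> u > 0"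
      using pos by (intro order_tendstoD(1)) auto
    then obtain d where d: "d > 0" "\<And>t. t \<noteq> 0 \<Longrightarrow> \<bar>t\<bar> < d \<Longrightarrow> q t \<bullet> u > 0"
      by (auto simp: eventually_at dist_real_def)
    define s where "s = min (d/2) (1/2)"
    have s: "0 < s" "s < d" "s < 1" using d(1) by (auto simp: s_def)
    obtain z where z: "0 < z" "z < s" "f s - f 0 = (s - 0) * (c1 z \<bullet> u)"
      using MVT2[OF \<open>0 < s\<close>, of f "\<lambda>t. c1 t \<bullet> u"] f_der s by auto
    have "c1 z \<bullet> u = z * (q z \<bullet> u)"
      using q(1)[of z] c1u by (simp add: inner_add_left)
    then have "f s - f 0 > 0" using z s d(2)[of z] by auto
    then show False using f_le[of s] s by auto
  qed
  with kap' have "c2 0 \<bullet> u = - curvature K p * a\<^sup>2" by simp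
  then show thesis using that[OF c U hom \<open>a \<noteq> 0\<close> c1a] by (simp add: u_def)
qed

lemma curvature_pos: "K \<in> C2_plus \<Longrightarrow> outer_normal_at K p u \<Longrightarrow> curvature K p > 0"
  by (simp add: C2_plus_def outer_normal_at_def)

text \<open>Two points with the same normal span a segment on the supporting line. Near
  \<open>p\<close> this segment runs inside the chart, where positive curvature makes
  \<open>p\<close> the only maximiser of the height: a contradiction.\<close>

lemma outer_normal_at_unique:
  assumes K: "K \<in> C2_plus" and p: "outer_normal_at K p (unit_vec \<phi>)"
    and p': "outer_normal_at K p' (unit_vec \<phi>)"
  shows "p = p'"
proof (rule ccontr)
  assume ne: "p \<noteq> p'"
  have Kb: "K \<in> convex_bodies" using K by (simp add: C2_plus_def)
  note K' = convex_bodiesD[OF Kb]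
  define u where "u = unit_vec \<phi>"
  obtain c c1 c2 U g a where c: "C2_chart (frontier K) p c c1 c2"
    and U: "open U" "p \<in> U" and hom: "homeomorphism {-1<..<1} (frontier K \<inter> U) c g"
    and a: "a \<noteq> 0" "c1 0 = a *\<^sub>R unit_tan \<phi>" "c2 0 \<bullet> u = - curvature K p * a\<^sup>2"
    using chart_at_support_point[OF K p] unfolding u_def by metis
  have c0: "c 0 = p"
    and der: "\<And>t. t\<in>{-1<..<1} \<Longrightarrow> (c has_vector_derivative c1 t) (at t)"
       "\<And>t. t\<in>{-1<..<1} \<Longrightarrow> (c1 has_vector_derivative c2 t) (at t)"
    using c unfolding C2_chart_def by blast+
  define f where "f t = c t \<bullet> u" for t
  have f_der: "(f has_real_derivative c1 t \<bullet> u) (at t)" if "t \<in> {-1<..<1}" for t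
    unfolding f_def has_real_derivative_iff_has_vector_derivative
    by (rule bounded_linear.has_vector_derivative[OF bounded_linear_inner_left der(1)[OF that]])
  obtain q where q: "\<And>t. c1 t = c1 0 + (t - 0) *\<^sub>R q t" "isCont q 0" "q 0 = c2 0"
    using vector_Caratheodory[OF der(2)[of 0]] by auto
  have "isCont (\<lambda>t. q t \<bullet> u) 0" using q(2) by (intro continuous_intros)
  then have "((\<lambda>t. q t \<bullet> u) \<longlongrightarrow> c2 0 \<bullet> u) (at 0)"
    unfolding isCont_def q(3) .
  moreover have "c2 0 \<bullet> u < 0"
    using a curvature_pos[OF K p] by (simp add: zero_less_mult_iff)
  ultimately have "\<forall>\<^sub>F t in at 0. q t \<bullet> u < 0"
    by (intro order_tendstoD(2)) auto
  then obtain d where d: "d > 0" "\<And>t. t \<noteq> 0 \<Longrightarrow> \<bar>t\<bar> < d \<Longrightarrow> q t \<bullet> u < 0"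
    by (auto simp: eventually_at dist_real_def)
  have c1q: "c1 t \<bullet> u = t * (q t \<bullet> u)" for t
    using q(1)[of t] a(2) by (simp add: u_def inner_add_left)
  \<comment> \<open>The slope \<open>c1 z \<bullet> u\<close> has the sign opposite to that of
    \<open>z\<close>, so the height falls on both sides of 0.\<close>
  have strict: "f t < f 0" if t: "t \<noteq> 0" "\<bar>t\<bar> < d" "\<bar>t\<bar> < 1" for t
  proof (cases "t > 0")
    case True
    obtain z where z: "0 < z" "z < t" "f t - f 0 = (t - 0) * (c1 z \<bullet> u)"
      using MVT2[OF True, of f "\<lambda>t. c1 t \<bullet> u"] f_der t by auto
    then have "q z \<bullet> u < 0" using t by (intro d(2)) auto
    then have "z * (q z \<bullet> u) < 0" using z by (simp add: mult_pos_neg)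
    then have "t * (z * (q z \<bullet> u)) < 0" using True by (rule mult_pos_neg[rotated])
    then show ?thesis using z c1q[of z] by simp
  next
    case False
    then have "t < 0" using t by simp
    then obtain z where z: "t < z" "z < 0" "f 0 - f t = (0 - t) * (c1 z \<bullet> u)"
      using MVT2[OF \<open>t < 0\<close>, of f "\<lambda>t. c1 t \<bullet> u"] f_der t by auto
    then have "q z \<bullet> u < 0" using t by (intro d(2)) auto
    then have "z * (q z \<bullet> u) > 0" using z by (simp add: mult_neg_neg)
    then have "t * (z * (q z \<bullet> u)) < 0" using \<open>t < 0\<close> by (simp add: mult_neg_pos)
    then show ?thesis using z c1q[of z] by simp
  qed
  have pK: "p \<in> K" "p' \<in> K" "p \<bullet> u = p' \<bullet> u"
    using p p' K' outer_normal_at_iff[of K] by (auto simp: inner_diff_left u_def intro: antisym)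
  have face: "outer_normal_at K (p + s *\<^sub>R (p' - p)) u" if "0 \<le> s" "s \<le> 1" for s
  proof -
    have "p + s *\<^sub>R (p' - p) = (1 - s) *\<^sub>R p + s *\<^sub>R p'" by (simp add: algebra_simps)
    then have "p + s *\<^sub>R (p' - p) \<in> K" using K' pK that by (simp add: convexD)
    moreover have "(y - (p + s *\<^sub>R (p' - p))) \<bullet> u = (y - p) \<bullet> u" for y
      using pK by (simp add: inner_diff_left inner_add_left)
    ultimately show ?thesis
      using p K' by (auto simp: outer_normal_at_iff u_def)
  qed
  have gcont: "continuous_on (frontier K \<inter> U) g" using hom by (simp add: homeomorphism_def)
  \<comment> \<open>As the segment points approach \<open>p\<close>, their chart parameters tend to
    0 by continuity of \<open>g\<close> and enter the range of \<open>strict\<close>; they are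
    nonzero because \<open>p \<noteq> p'\<close>.\<close>
  let ?F = "at_right (0::real)"
  have lim: "((\<lambda>s. p + s *\<^sub>R (p' - p)) \<longlongrightarrow> p + 0 *\<^sub>R (p' - p)) ?F"
    by (intro tendsto_intros)
  then have evU: "\<forall>\<^sub>F s in ?F. p + s *\<^sub>R (p' - p) \<in> U"
    by (rule topological_tendstoD) (use U in auto)
  have ev1: "\<forall>\<^sub>F s in ?F. 0 < s \<and> s < 1"
    using eventually_at_right_less[of 0] eventually_at_right_real[of 0 1] by (auto elim: eventually_mono)
  have evS: "\<forall>\<^sub>F s in ?F. p + s *\<^sub>R (p' - p) \<in> frontier K \<inter> U"
    using evU ev1 by eventually_elim (use face in \<open>auto simp: outer_normal_at_def\<close>)
  have pS: "p \<in> frontier K \<inter> U" using p U by (simp add: outer_normal_at_def)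
  have g0: "g p = 0" using hom c0 by (auto simp: homeomorphism_def)
  have "((\<lambda>s. g (p + s *\<^sub>R (p' - p))) \<longlongrightarrow> g p) ?F"
    by (rule continuous_on_tendsto_compose[OF gcont _ pS evS]) (use lim in auto)
  then have "\<forall>\<^sub>F s in ?F. \<bar>g (p + s *\<^sub>R (p' - p))\<bar> < min d 1"
    using d(1) g0 tendstoD[of "\<lambda>s. g (p + s *\<^sub>R (p' - p))" 0 ?F "min d 1"] by (simp add: dist_real_def)
  with evS ev1 have "\<forall>\<^sub>F s in ?F. False"
  proof eventually_elim
    case (elim s)
    define y where "y = p + s *\<^sub>R (p' - p)"
    have "c (g y) = y" using hom elim by (simp add: homeomorphism_def y_def)
    moreover have "y \<noteq> p" using elim ne by (simp add: y_def)
    ultimately have "g y \<noteq> 0" using c0 by auto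
    then have "f (g y) < f 0" using elim by (intro strict) (auto simp: y_def)
    then have "y \<bullet> u < p \<bullet> u" using \<open>c (g y) = y\<close> c0 by (simp add: f_def)
    then show False using pK by (simp add: y_def inner_add_left inner_diff_left)
  qed
  then show False by simp
qed

section \<open>The support point as a function of the angle\<close>

definition support_point :: "(real^2) set \<Rightarrow> real \<Rightarrow> real^2" where
  "support_point K \<phi> = (THE p. outer_normal_at K p (unit_vec \<phi>))"

lemma outer_normal_at_support_point:
  assumes "K \<in> C2_plus"
  shows "outer_normal_at K (support_point K \<phi>) (unit_vec \<phi>)"
proof -
  have "K \<in> convex_bodies" using assms by (simp add: C2_plus_def)
  then obtain p where "outer_normal_at K p (unit_vec \<phi>)" by (rule outer_normal_at_exists)
  then show ?thesis
    unfolding support_point_def by (rule theI) (erule outer_normal_at_unique[OF assms], fact)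
qed

lemma support_point_eqI:
  "K \<in> C2_plus \<Longrightarrow> outer_normal_at K p (unit_vec \<phi>) \<Longrightarrow> support_point K \<phi> = p"
  using outer_normal_at_unique outer_normal_at_support_point by blast

lemma radius_of_curvature_support_point:
  "radius_of_curvature K (unit_vec \<phi>) = 1 / curvature K (support_point K \<phi>)"
  by (simp add: radius_of_curvature_def support_point_def)

lemma radius_of_curvature_pos:
  "K \<in> C2_plus \<Longrightarrow> radius_of_curvature K (unit_vec \<phi>) > 0"
  by (simp add: radius_of_curvature_support_point
      curvature_pos[OF _ outer_normal_at_support_point])

text \<open>Closed graph argument with values in the compact set \<open>K\<close>: by uniqueness,
  membership in the graph amounts to \<open>p \<in> K\<close> and one closed inequality for each
  \<open>y \<in> K\<close>.\<close>

lemma continuous_on_support_point: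
  assumes K: "K \<in> C2_plus"
  shows "continuous_on S (support_point K)"
proof -
  have Kb: "K \<in> convex_bodies" using K by (simp add: C2_plus_def)
  note K' = convex_bodiesD[OF Kb]
  have "support_point K \<phi> = p \<longleftrightarrow> p \<in> K \<and> (\<forall>y\<in>K. (y - p) \<bullet> unit_vec \<phi> \<le> 0)" for \<phi> p
    using support_point_eqI[OF K, of p \<phi>] outer_normal_at_support_point[OF K, of \<phi>] K'
    by (auto simp: outer_normal_at_iff)
  note sp = this
  have eq: "range (\<lambda>\<phi>. (\<phi>, support_point K \<phi>)) =
      {z. snd z \<in> K} \<inter> (\<Inter>y\<in>K. {z. (y - snd z) \<bullet> unit_vec (fst z) \<le> 0})"
    (is "_ = ?R")
  proof -
    have "range (\<lambda>\<phi>. (\<phi>, support_point K \<phi>)) = {z. support_point K (fst z) = snd z}"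
      by force
    also have "\<dots> = ?R" by (auto simp: sp)
    finally show ?thesis .
  qed
  have "closed (range (\<lambda>\<phi>. (\<phi>, support_point K \<phi>)))"
    unfolding eq using K'
    by (intro closed_Int closed_INT ballI closed_Collect_le continuous_intros)
       (auto intro: closed_vimage_snd simp: vimage_def[symmetric])
  then have "continuous_on UNIV (support_point K)"
    using K' outer_normal_at_support_point[OF K]
    by (intro continuous_from_closed_graph[where T=K]) (auto simp: outer_normal_at_iff)
  then show ?thesis by (rule continuous_on_subset) simp
qed

text \<open>Along a chart \<open>c\<close>, the parameter \<open>\<tau>\<close> of the support point solves \<open>c'(\<tau>(\<phi>)) \<bullet> u(\<phi>) = 0\<close>;
  dividing this equation by its linear part in \<open>\<tau>\<close> gives the derivative of \<open>\<tau>\<close> without an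
  implicit function theorem.\<close>

lemma support_point_has_vector_derivative:
  assumes K: "K \<in> C2_plus"
  shows "(support_point K has_vector_derivative
    radius_of_curvature K (unit_vec \<phi>) *\<^sub>R unit_tan \<phi>) (at \<phi>)"
proof -
  let ?P = "support_point K"
  have Kb: "K \<in> convex_bodies" using K by (simp add: C2_plus_def)
  note K' = convex_bodiesD[OF Kb]
  define p where "p = ?P \<phi>"
  have p: "outer_normal_at K p (unit_vec \<phi>)"
    using outer_normal_at_support_point[OF K] by (simp add: p_def)
  define k where "k = curvature K p"
  have "k > 0" using curvature_pos[OF K p] by (simp add: k_def)
  define u where "u = unit_vec \<phi>"
  obtain c c1 c2 U g a where c: "C2_chart (frontier K) p c c1 c2"
    and U: "open U" "p \<in> U" and hom: "homeomorphism {-1<..<1} (frontier K \<inter> U) c g"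
    and a: "a \<noteq> 0" "c1 0 = a *\<^sub>R unit_tan \<phi>" "c2 0 \<bullet> u = - k * a\<^sup>2"
    using chart_at_support_point[OF K p] unfolding u_def k_def by metis
  have c0: "c 0 = p"
    and der: "\<And>t. t\<in>{-1<..<1} \<Longrightarrow> (c has_vector_derivative c1 t) (at t)"
       "\<And>t. t\<in>{-1<..<1} \<Longrightarrow> (c1 has_vector_derivative c2 t) (at t)"
    using c unfolding C2_chart_def by blast+
  have cK: "c t \<in> K" if "t \<in> {-1<..<1}" for t
    using homeomorphism_image1[OF hom] that frontier_subset_closed K' by blast
  obtain q where q: "\<And>t. c1 t = c1 0 + (t - 0) *\<^sub>R q t" "isCont q 0" "q 0 = c2 0"
    using vector_Caratheodory[OF der(2)[of 0]] by auto
  obtain q' where q': "\<And>t. c t = c 0 + (t - 0) *\<^sub>R q' t" "isCont q' 0" "q' 0 = c1 0"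
    using vector_Caratheodory[OF der(1)[of 0]] by auto
  define \<tau> where "\<tau> y = g (?P y)" for y
  let ?F = "at \<phi>"
  have limP: "(?P \<longlongrightarrow> p) ?F"
    using continuous_on_support_point[OF K, of UNIV]
    by (simp add: p_def continuous_on_eq_continuous_at isCont_def)
  have "\<forall>\<^sub>F y in ?F. ?P y \<in> U"
    using limP by (rule topological_tendstoD) (use U in auto)
  then have evS: "\<forall>\<^sub>F y in ?F. ?P y \<in> frontier K \<inter> U"
    by eventually_elim (use outer_normal_at_support_point[OF K] in \<open>auto simp: outer_normal_at_def\<close>)
  have pS: "p \<in> frontier K \<inter> U" using p U by (simp add: outer_normal_at_def)
  have "g p = 0" using hom c0 by (auto simp: homeomorphism_def)
  moreover have "continuous_on (frontier K \<inter> U) g" using hom by (simp add: homeomorphism_def)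
  ultimately have lim\<tau>: "(\<tau> \<longlongrightarrow> 0) ?F"
    unfolding \<tau>_def using continuous_on_tendsto_compose[OF _ limP pS evS, of g] by simp
  \<comment> \<open>\<open>\<tau> y\<close> maximises the height in direction
    \<open>unit_vec y\<close> over the chart interval, so the derivative of this height vanishes
    there.\<close>
  have ev\<tau>: "\<forall>\<^sub>F y in ?F. c (\<tau> y) = ?P y \<and> c1 (\<tau> y) \<bullet> unit_vec y = 0"
    using evS
  proof eventually_elim
    case (elim y)
    have cy: "c (\<tau> y) = ?P y" and ty: "\<tau> y \<in> {-1<..<1}"
      using hom elim by (auto simp: homeomorphism_def \<tau>_def)
    have "((\<lambda>t. c t \<bullet> unit_vec y) has_real_derivative c1 (\<tau> y) \<bullet> unit_vec y) (at (\<tau> y))"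
      unfolding has_real_derivative_iff_has_vector_derivative
      by (rule bounded_linear.has_vector_derivative[OF bounded_linear_inner_left der(1)[OF ty]])
    moreover have "c t \<bullet> unit_vec y \<le> c (\<tau> y) \<bullet> unit_vec y" if "t \<in> {-1<..<1}" for t
      using outer_normal_at_support_point[OF K, of y] cK[OF that]
      by (auto simp: cy outer_normal_at_def inner_diff_left)
    ultimately have "c1 (\<tau> y) \<bullet> unit_vec y = 0"
      using ty
      by (intro DERIV_local_max[of "\<lambda>t. c t \<bullet> unit_vec y" _ "\<tau> y" "min (1 - \<tau> y) (1 + \<tau> y)"])
         (auto simp: abs_less_iff)
    with cy show ?case by simp
  qed
  have limu: "(unit_vec \<longlongrightarrow> u) ?F"
    using continuous_on_unit_vec[OF continuous_on_id, of UNIV]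
    by (simp add: u_def continuous_on_eq_continuous_at isCont_def)
  have limq: "((\<lambda>y. q (\<tau> y) \<bullet> unit_vec y) \<longlongrightarrow> - k * a\<^sup>2) ?F"
    unfolding a(3)[symmetric]
    using isCont_tendsto_compose[OF q(2) lim\<tau>] limu q(3) by (auto intro!: tendsto_inner)
  have nz: "- k * a\<^sup>2 \<noteq> 0" using \<open>k > 0\<close> a(1) by simp
  have evq: "\<forall>\<^sub>F y in ?F. q (\<tau> y) \<bullet> unit_vec y \<noteq> 0"
    using tendsto_imp_eventually_ne[OF limq nz] .
  have limc: "((\<lambda>y. (c1 0 \<bullet> unit_vec y) / (y - \<phi>)) \<longlongrightarrow> a) ?F"
  proof -
    have "((\<lambda>y. c1 0 \<bullet> unit_vec y) has_real_derivative c1 0 \<bullet> unit_tan \<phi>) (at \<phi>)"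
      unfolding has_real_derivative_iff_has_vector_derivative
      by (rule bounded_linear.has_vector_derivative[OF bounded_linear_inner_right
            has_vector_derivative_unit_vec])
    then show ?thesis
      unfolding has_field_derivative_iff by (simp add: a(2))
  qed
  \<comment> \<open>Solving \<open>c1 0 \<bullet> unit_vec y + \<tau> y * (q (\<tau> y) \<bullet>
    unit_vec y) = 0\<close> for \<open>\<tau> y\<close> and inserting it into
    \<open>?P y - ?P \<phi> = \<tau> y *\<^sub>R q' (\<tau> y)\<close> gives this form of the slope.
    Its limit is \<open>1 / (k * a)\<close> times \<open>a *\<^sub>R unit_tan \<phi>\<close>; the
    chart speed \<open>a\<close> cancels.\<close>
  have "((\<lambda>y. (- ((c1 0 \<bullet> unit_vec y) / (y - \<phi>)) / (q (\<tau> y) \<bullet> unit_vec y)) *\<^sub>R q' (\<tau> y))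
      \<longlongrightarrow> (- a / (- k * a\<^sup>2)) *\<^sub>R c1 0) ?F"
    using isCont_tendsto_compose[OF q'(2) lim\<tau>] nz q'(3)
    by (intro tendsto_intros limc limq) auto
  also have "(- a / (- k * a\<^sup>2)) *\<^sub>R c1 0 = radius_of_curvature K (unit_vec \<phi>) *\<^sub>R unit_tan \<phi>"
    using a(1) \<open>k > 0\<close>
    by (simp add: a(2) radius_of_curvature_support_point power2_eq_square
        flip: p_def k_def)
  finally have "((\<lambda>y. (?P y - ?P \<phi>) /\<^sub>R (y - \<phi>)) \<longlongrightarrow>
     radius_of_curvature K (unit_vec \<phi>) *\<^sub>R unit_tan \<phi>) ?F"
  proof (rule Lim_transform_eventually)
    show "\<forall>\<^sub>F y in ?F. (- ((c1 0 \<bullet> unit_vec y) / (y - \<phi>)) / (q (\<tau> y) \<bullet> unit_vec y)) *\<^sub>R q' (\<tau> y)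
       = (?P y - ?P \<phi>) /\<^sub>R (y - \<phi>)"
      using ev\<tau> evq
    proof eventually_elim
      case (elim y)
      have "c1 0 \<bullet> unit_vec y + \<tau> y * (q (\<tau> y) \<bullet> unit_vec y) = 0"
        using elim q(1)[of "\<tau> y"] by (metis diff_zero inner_add_left inner_scaleR_left)
      then have "- (c1 0 \<bullet> unit_vec y) / (q (\<tau> y) \<bullet> unit_vec y) = \<tau> y"
        using elim by (simp add: field_simps)
      then have "- ((c1 0 \<bullet> unit_vec y) / (y - \<phi>)) / (q (\<tau> y) \<bullet> unit_vec y) = \<tau> y / (y - \<phi>)"
        by (metis divide_divide_eq_left' divide_divide_eq_left minus_divide_left)
      moreover have "?P y - ?P \<phi> = \<tau> y *\<^sub>R q' (\<tau> y)"
        using elim q'(1)[of "\<tau> y"] c0 by (simp add: p_def) (metis add_diff_cancel_left')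
      ultimately show ?case by (simp add: divide_inverse_commute)
    qed
  qed
  then show ?thesis by (simp only: has_vector_derivative_iff_slope)
qed

subsection \<open>Lebesgue measure in the plane\<close>

lemma Basis_vec2: "(Basis :: (real^2) set) = {axis 1 1, axis 2 1}"
  by (auto simp: Basis_vec_def UNIV_2)

lemma measurable_vector_pair [measurable]:
  "(\<lambda>z. vector [fst z, snd z] :: real^2) \<in> lborel \<Otimes>\<^sub>M lborel \<rightarrow>\<^sub>M borel"
proof -
  have "(\<lambda>z. vector [fst z, snd z] :: real^2) = (\<lambda>z. fst z *\<^sub>R axis 1 1 + snd z *\<^sub>R axis 2 1)"
    by (auto simp: vec2_eq_iff axis_def)
  moreover have "(\<lambda>z. fst z *\<^sub>R axis 1 1 + snd z *\<^sub>R axis 2 1 :: real^2) \<in> lborel \<Otimes>\<^sub>M lborel \<rightarrow>\<^sub>M borel"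
    by measurable
  ultimately show ?thesis by simp
qed

lemma measurable_vec_nth2 [measurable]: "(\<lambda>v::real^2. v $ i) \<in> borel \<rightarrow>\<^sub>M borel"
  by (intro borel_measurable_continuous_onI continuous_intros)

text \<open>Lebesgue measure is characterised by its values on boxes, which correspond to products
  of intervals. This opens \<open>real^2\<close> to iterated integration.\<close>

lemma lborel_plane:
  "(lborel :: (real^2) measure) = distr (lborel \<Otimes>\<^sub>M lborel) borel (\<lambda>z. vector [fst z, snd z])"
proof (rule lborel_eqI)
  fix l u :: "real^2" assume le: "\<And>b. b \<in> Basis \<Longrightarrow> l \<bullet> b \<le> u \<bullet> b"
  have le': "l $ 1 \<le> u $ 1" "l $ 2 \<le> u $ 2"
    using le[of "axis 1 1"] le[of "axis 2 1"] by (auto simp: Basis_vec2 inner_axis)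
  have eq: "(\<lambda>z. vector [fst z, snd z] :: real^2) -` box l u = {l$1<..<u$1} \<times> {l$2<..<u$2}"
    by (auto simp: mem_box Basis_vec2 inner_axis)
  have "emeasure (distr (lborel \<Otimes>\<^sub>M lborel) borel (\<lambda>z. vector [fst z, snd z])) (box l u)
      = emeasure (lborel \<Otimes>\<^sub>M lborel) ({l$1<..<u$1} \<times> {l$2<..<u$2})"
    by (subst emeasure_distr) (auto simp: eq space_pair_measure)
  also have "\<dots> = ennreal ((u$1 - l$1) * (u$2 - l$2))"
    using le' by (subst lborel.emeasure_pair_measure_Times) (auto simp: ennreal_mult)
  also have "(u$1 - l$1) * (u$2 - l$2) = (\<Prod>b\<in>Basis. (u - l) \<bullet> b)"
    by (simp add: Basis_vec2 axis_eq_axis inner_axis)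
  finally show "emeasure (distr (lborel \<Otimes>\<^sub>M lborel) borel (\<lambda>z. vector [fst z, snd z])) (box l u)
      = ennreal (\<Prod>b\<in>Basis. (u - l) \<bullet> b)" .
qed simp

lemma nn_integral_plane:
  fixes f :: "real^2 \<Rightarrow> ennreal"
  assumes [measurable]: "f \<in> borel_measurable borel"
  shows "(\<integral>\<^sup>+v. f v \<partial>lborel) = (\<integral>\<^sup>+x. \<integral>\<^sup>+y. f (vector [x, y]) \<partial>lborel \<partial>lborel)"
proof -
  have "(\<integral>\<^sup>+v. f v \<partial>lborel) = (\<integral>\<^sup>+z. f (vector [fst z, snd z]) \<partial>(lborel \<Otimes>\<^sub>M lborel))"
    by (subst lborel_plane, subst nn_integral_distr) auto
  also have "\<dots> = (\<integral>\<^sup>+x. \<integral>\<^sup>+y. f (vector [x, y]) \<partial>lborel \<partial>lborel)"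
    by (subst lborel.nn_integral_fst[symmetric]) auto
  finally show ?thesis .
qed

subsection \<open>The local Steiner formula\<close>

lemma has_real_derivative_imp_LIMSEQ:
  assumes "(f has_real_derivative D) (at x)"
  shows "(\<lambda>n. (f (x + 1 / real (Suc n)) - f x) * real (Suc n)) \<longlonglongrightarrow> D"
proof -
  have "((\<lambda>h. (f (x + h) - f x) / h) \<longlongrightarrow> D) (at 0)"
    using assms by (simp add: DERIV_def)
  moreover have "filterlim (\<lambda>n. 1 / real (Suc n)) (at 0) sequentially"
    using LIMSEQ_inverse_real_of_nat
    by (intro filterlim_atI) (auto simp: inverse_eq_divide)
  ultimately have "(\<lambda>n. (f (x + 1 / real (Suc n)) - f x) / (1 / real (Suc n))) \<longlonglongrightarrow> D"
    by (rule filterlim_compose)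
  then show ?thesis by simp
qed

text \<open>Product rule with derivative \<open>- unit_vec \<phi>\<close> of
  \<open>unit_tan\<close>. As the support function h has derivative
  \<open>support_point K \<phi> \<bullet> unit_tan \<phi>\<close>, this is the identity r = h'' +
  h.\<close>

lemma support_point_tan_has_derivative:
  assumes "K \<in> C2_plus"
  shows "((\<lambda>\<phi>. support_point K \<phi> \<bullet> unit_tan \<phi>) has_real_derivative
     radius_of_curvature K (unit_vec \<phi>) - support_point K \<phi> \<bullet> unit_vec \<phi>) (at \<phi>)"
  unfolding has_real_derivative_iff_has_vector_derivative
  by (rule has_vector_derivative_eq_rhs,
      rule bounded_bilinear.has_vector_derivative[OF bounded_bilinear_inner
        support_point_has_vector_derivative[OF assms] has_vector_derivative_unit_tan]) simp

lemma support_point_vec_has_derivative: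
  assumes "K \<in> C2_plus"
  shows "((\<lambda>\<phi>. support_point K \<phi> \<bullet> unit_vec \<phi>) has_real_derivative
     support_point K \<phi> \<bullet> unit_tan \<phi>) (at \<phi>)"
  unfolding has_real_derivative_iff_has_vector_derivative
  by (rule has_vector_derivative_eq_rhs,
      rule bounded_bilinear.has_vector_derivative[OF bounded_bilinear_inner
        support_point_has_vector_derivative[OF assms] has_vector_derivative_unit_vec]) simp

lemma measurable_support_point:
  "K \<in> C2_plus \<Longrightarrow> support_point K \<in> borel_measurable borel"
  by (intro borel_measurable_continuous_onI continuous_on_support_point)

lemma measurable_unit_vec [measurable]: "unit_vec \<in> borel_measurable borel"
  by (intro borel_measurable_continuous_onI continuous_intros)

lemma measurable_unit_tan [measurable]: "unit_tan \<in> borel_measurable borel"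
  by (intro borel_measurable_continuous_onI continuous_intros)

text \<open>The radius minus the support function is a pointwise limit of Borel difference
  quotients; the support function is then added back.\<close>

lemma measurable_radius_of_curvature:
  assumes K: "K \<in> C2_plus"
  shows "(\<lambda>\<phi>. radius_of_curvature K (unit_vec \<phi>)) \<in> borel_measurable borel"
proof -
  note [measurable] = measurable_support_point[OF K]
  let ?m = "\<lambda>\<phi>. support_point K \<phi> \<bullet> unit_tan \<phi>"
  have "(\<lambda>\<phi>. radius_of_curvature K (unit_vec \<phi>) - support_point K \<phi> \<bullet> unit_vec \<phi>)
      \<in> borel_measurable borel"
    by (rule borel_measurable_LIMSEQ_real[where u = "\<lambda>n \<phi>. (?m (\<phi> + 1 / real (Suc n)) - ?m \<phi>) * real (Suc n)"],
        rule has_real_derivative_imp_LIMSEQ[OF support_point_tan_has_derivative[OF K]]) measurable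
  then have "(\<lambda>\<phi>. (radius_of_curvature K (unit_vec \<phi>) - support_point K \<phi> \<bullet> unit_vec \<phi>)
       + support_point K \<phi> \<bullet> unit_vec \<phi>) \<in> borel_measurable borel"
    by measurable
  then show ?thesis by simp
qed

section \<open>Normal coordinates outside the body: angle \<open>v $ 1\<close>, distance
  \<open>v $ 2\<close>\<close>

definition normal_map :: "(real^2) set \<Rightarrow> real^2 \<Rightarrow> real^2" where
  "normal_map K v = support_point K (v $ 1) + (v $ 2) *\<^sub>R unit_vec (v $ 1)"

definition local_parallel_set :: "(real^2) set \<Rightarrow> real \<Rightarrow> ((real^2) \<times> (real^2)) set \<Rightarrow> (real^2) set" where
  "local_parallel_set K \<epsilon> \<eta> = {x \<in> (K + cball 0 \<epsilon>) - K.
     (closest_point K x, sgn (x - closest_point K x)) \<in> \<eta>}"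

definition normal_directions :: "(real^2) set \<Rightarrow> ((real^2) \<times> (real^2)) set \<Rightarrow> real set" where
  "normal_directions K \<eta> = {\<phi> \<in> {0..<2*pi}. (support_point K \<phi>, unit_vec \<phi>) \<in> \<eta>}"

abbreviation normal_bundle_borel :: "((real^2) \<times> (real^2)) measure" where
  "normal_bundle_borel \<equiv> restrict_space borel (UNIV \<times> sphere 0 1)"

lemma sets_normal_bundle_borel: "\<eta> \<in> sets normal_bundle_borel \<Longrightarrow> \<eta> \<in> sets borel"
  by (subst (asm) sets_restrict_space_iff) (auto intro!: borel_closed closed_Times)

text \<open>Every \<open>z \<in> K\<close> has distance at least \<open>t\<close> from the point,
  since \<open>(p + t *\<^sub>R u - z) \<bullet> u \<ge> t\<close>; nearest points are
  unique.\<close>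

lemma closest_point_along_normal:
  assumes "K \<in> convex_bodies" and p: "outer_normal_at K p u" and "t \<ge> 0"
  shows "closest_point K (p + t *\<^sub>R u) = p"
proof -
  note K' = convex_bodiesD[OF assms(1)]
  have pK: "p \<in> K" "norm u = 1" "\<And>y. y \<in> K \<Longrightarrow> (y - p) \<bullet> u \<le> 0"
    using p K' by (auto simp: outer_normal_at_iff)
  have "dist (p + t *\<^sub>R u) p \<le> dist (p + t *\<^sub>R u) z" if "z \<in> K" for z
  proof -
    have "t = (t *\<^sub>R u) \<bullet> u" using pK(2) by (simp add: dot_square_norm)
    also have "\<dots> \<le> (p + t *\<^sub>R u - z) \<bullet> u"
      using pK(3)[OF that] by (simp add: inner_diff_left inner_add_left)
    also have "\<dots> \<le> norm (p + t *\<^sub>R u - z)"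
      using norm_cauchy_schwarz[of "p + t *\<^sub>R u - z" u] pK(2) by simp
    finally show ?thesis using pK(2) \<open>t \<ge> 0\<close> by (simp add: dist_norm)
  qed
  then show ?thesis using closest_point_unique[of K p] K' pK(1) by auto
qed

lemma outer_normal_at_closest_point:
  assumes "K \<in> convex_bodies" "x \<notin> K"
  shows "outer_normal_at K (closest_point K x) (sgn (x - closest_point K x))"
proof -
  note K' = convex_bodiesD[OF assms(1)]
  have cK: "closest_point K x \<in> K" using K' closest_point_in_set by blast
  then have ne: "x - closest_point K x \<noteq> 0" using assms(2) by auto
  have "(y - closest_point K x) \<bullet> (x - closest_point K x) \<le> 0" if "y \<in> K" for y
    using closest_point_dot[of K y x] K' that by (simp add: inner_commute)
  then have "(y - closest_point K x) \<bullet> sgn (x - closest_point K x) \<le> 0" if "y \<in> K" for y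
    using that by (simp add: sgn_div_norm mult_nonneg_nonpos)
  then show ?thesis using K' cK ne by (auto simp: outer_normal_at_iff norm_sgn)
qed

lemma mem_parallel_iff:
  assumes "K \<in> convex_bodies"
  shows "x \<in> K + cball 0 \<epsilon> \<longleftrightarrow> dist x (closest_point K x) \<le> \<epsilon>"
proof -
  note K' = convex_bodiesD[OF assms(1)]
  have cK: "closest_point K x \<in> K" using K' closest_point_in_set by blast
  show ?thesis
  proof
    assume "x \<in> K + cball 0 \<epsilon>"
    then obtain y b where "y \<in> K" "norm b \<le> \<epsilon>" "x = y + b" by (auto elim: set_plus_elim)
    then show "dist x (closest_point K x) \<le> \<epsilon>"
      using closest_point_le[of K y x] K' by (auto simp: dist_norm)
  next
    assume "dist x (closest_point K x) \<le> \<epsilon>"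
    then have "closest_point K x + (x - closest_point K x) \<in> K + cball 0 \<epsilon>"
      using cK by (intro set_plus_intro) (auto simp: dist_norm norm_minus_commute)
    then show "x \<in> K + cball 0 \<epsilon>" by simp
  qed
qed

lemma normal_map_properties:
  assumes K: "K \<in> C2_plus" and "v $ 2 > 0"
  shows "closest_point K (normal_map K v) = support_point K (v $ 1)"
    "normal_map K v \<notin> K"
    "sgn (normal_map K v - closest_point K (normal_map K v)) = unit_vec (v $ 1)"
    "dist (normal_map K v) (closest_point K (normal_map K v)) = v $ 2"
proof -
  have Kb: "K \<in> convex_bodies" using K by (simp add: C2_plus_def)
  note sp = outer_normal_at_support_point[OF K, of "v $ 1"]
  show 1: "closest_point K (normal_map K v) = support_point K (v $ 1)"
    unfolding normal_map_def using closest_point_along_normal[OF Kb sp] assms(2) by simp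
  show "sgn (normal_map K v - closest_point K (normal_map K v)) = unit_vec (v $ 1)"
    using assms(2) unfolding 1 by (simp add: normal_map_def sgn_scaleR sgn_div_norm)
  show d: "dist (normal_map K v) (closest_point K (normal_map K v)) = v $ 2"
    using assms(2) unfolding 1 by (simp add: normal_map_def dist_norm)
  show "normal_map K v \<notin> K"
    using d assms(2) closest_point_self[of "normal_map K v" K] by auto
qed

text \<open>A point outside \<open>K\<close> lies on the ray from its nearest point along an outer
  normal there, and uniqueness makes this nearest point the support point of that angle. Distance 0
  is excluded because it lands in \<open>K\<close>.\<close>

lemma normal_map_image:
  assumes K: "K \<in> C2_plus" and "\<epsilon> > 0"
  shows "normal_map K ` {v. v $ 1 \<in> normal_directions K \<eta> \<and> v $ 2 \<in> {0<..\<epsilon>}}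
     = local_parallel_set K \<epsilon> \<eta>" (is "_ ` ?S = ?A")
proof (intro equalityI subsetI)
  have Kb: "K \<in> convex_bodies" using K by (simp add: C2_plus_def)
  {
    fix x assume "x \<in> normal_map K ` ?S"
    then show "x \<in> ?A"
      using normal_map_properties[OF K]
      by (auto simp: local_parallel_set_def mem_parallel_iff[OF Kb] normal_directions_def)
  next
    fix x assume x: "x \<in> ?A"
    define q where "q = closest_point K x"
    have xK: "x \<notin> K" "dist x q \<le> \<epsilon>" "(q, sgn (x - q)) \<in> \<eta>"
      using x by (auto simp: local_parallel_set_def mem_parallel_iff[OF Kb] q_def)
    have q: "outer_normal_at K q (sgn (x - q))"
      using outer_normal_at_closest_point[OF Kb xK(1)] by (simp add: q_def)
    then have "norm (sgn (x - q)) = 1" by (simp add: outer_normal_at_def)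
    then obtain \<phi> where \<phi>: "\<phi> \<in> {0..<2*pi}" "sgn (x - q) = unit_vec \<phi>"
      by (rule norm_eq_1_unit_vecE)
    have sp: "support_point K \<phi> = q" using support_point_eqI[OF K, of q \<phi>] q \<phi>(2) by simp
    define v where "v = (vector [\<phi>, norm (x - q)] :: real^2)"
    have "x - q \<noteq> 0" using \<open>norm (sgn (x - q)) = 1\<close> by fastforce
    have "normal_map K v = q + norm (x - q) *\<^sub>R sgn (x - q)"
      by (simp add: normal_map_def v_def sp \<phi>(2))
    also have "\<dots> = x" using \<open>x - q \<noteq> 0\<close> by (simp add: sgn_div_norm)
    finally have "x = normal_map K v" by simp
    moreover have "v \<in> ?S"
      using \<phi> sp xK \<open>x - q \<noteq> 0\<close> by (auto simp: v_def normal_directions_def dist_norm)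
    ultimately show "x \<in> normal_map K ` ?S" by blast
  }
qed

text \<open>Both coordinates can be recovered from the image point: the distance to its nearest
  point and the direction from there, which fixes the angle in a half-open period.\<close>

lemma inj_on_normal_map:
  assumes K: "K \<in> C2_plus"
  shows "inj_on (normal_map K) {v. v $ 1 \<in> {0..<2*pi} \<and> v $ 2 > 0}"
proof (rule inj_onI)
  fix v w assume v: "v \<in> {v. v $ 1 \<in> {0..<2*pi} \<and> v $ 2 > 0}"
    and w: "w \<in> {v. v $ 1 \<in> {0..<2*pi} \<and> v $ 2 > 0}" and eq: "normal_map K v = normal_map K w"
  have "unit_vec (v $ 1) = unit_vec (w $ 1)" "v $ 2 = w $ 2"
    using normal_map_properties(3,4)[OF K, of v] normal_map_properties(3,4)[OF K, of w] v w eq by auto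
  moreover from this(1) have "v $ 1 = w $ 1"
    using inj_on_unit_vec v w by (auto dest: inj_onD)
  ultimately show "v = w" by (simp add: vec2_eq_iff)
qed

lemma normal_map_has_derivative:
  assumes K: "K \<in> C2_plus"
  shows "(normal_map K has_derivative
    (\<lambda>w. (w $ 1 * (radius_of_curvature K (unit_vec (v $ 1)) + v $ 2)) *\<^sub>R unit_tan (v $ 1)
         + (w $ 2) *\<^sub>R unit_vec (v $ 1))) (at v)"
proof -
  have nth: "((\<lambda>w::real^2. w $ i) has_derivative (\<lambda>w. w $ i)) (at v)" for i
    by (rule bounded_linear_imp_has_derivative) (rule bounded_linear_vec_nth)
  have 1: "((\<lambda>w. support_point K (w $ 1)) has_derivative
      (\<lambda>w. (w $ 1) *\<^sub>R (radius_of_curvature K (unit_vec (v $ 1)) *\<^sub>R unit_tan (v $ 1)))) (at v)"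
    using has_derivative_compose[OF nth[of 1]
        support_point_has_vector_derivative[OF K, unfolded has_vector_derivative_def]] .
  have 2: "((\<lambda>w. unit_vec (w $ 1)) has_derivative (\<lambda>w. (w $ 1) *\<^sub>R unit_tan (v $ 1))) (at v)"
    using has_derivative_compose[OF nth[of 1]
        has_vector_derivative_unit_vec[unfolded has_vector_derivative_def]] .
  have "((\<lambda>w. support_point K (w $ 1) + (w $ 2) *\<^sub>R unit_vec (w $ 1)) has_derivative
    (\<lambda>w. (w $ 1) *\<^sub>R (radius_of_curvature K (unit_vec (v $ 1)) *\<^sub>R unit_tan (v $ 1)) +
        ((v $ 2) *\<^sub>R ((w $ 1) *\<^sub>R unit_tan (v $ 1)) + (w $ 2) *\<^sub>R unit_vec (v $ 1)))) (at v)"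
    by (intro has_derivative_add 1 has_derivative_scaleR nth 2)
  then show ?thesis
    unfolding normal_map_def[abs_def] by (rule has_derivative_eq_rhs) (auto simp: algebra_simps)
qed

text \<open>The frame \<open>(unit_tan \<phi>, unit_vec \<phi>)\<close> is negatively oriented,
  hence the sign. For the normal map, \<open>c\<close> is radius plus distance.\<close>

lemma det_normal_map:
  "det (matrix (\<lambda>w. (w $ 1 * c) *\<^sub>R unit_tan \<phi> + (w $ 2) *\<^sub>R unit_vec \<phi>) :: real^2^2) = - c"
proof -
  have *: "c = c * (cos \<phi> * cos \<phi>) + c * (sin \<phi> * sin \<phi>)"
    using sin_cos_squared_add2[of \<phi>] by (metis distrib_left mult_1_right power2_eq_square)
  show ?thesis
    by (simp add: det_2 matrix_def axis_def algebra_simps) (rule *)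
qed

section \<open>Areas of local parallel sets by change of variables\<close>

lemma sets_normal_directions:
  assumes K: "K \<in> C2_plus" and \<eta>: "\<eta> \<in> sets normal_bundle_borel"
  shows "normal_directions K \<eta> \<in> sets borel"
proof -
  note [measurable] = measurable_support_point[OF K]
  have [measurable]: "\<eta> \<in> sets (borel \<Otimes>\<^sub>M borel)"
    unfolding borel_prod by (rule sets_normal_bundle_borel[OF \<eta>])
  have "(\<lambda>\<phi>. (support_point K \<phi>, unit_vec \<phi>)) -` \<eta> \<inter> space borel \<in> sets borel"
    by measurable
  moreover have "normal_directions K \<eta> = {0..<2*pi} \<inter> ((\<lambda>\<phi>. (support_point K \<phi>, unit_vec \<phi>)) -` \<eta> \<inter> space borel)"
    by (auto simp: normal_directions_def)
  ultimately show ?thesis by simp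
qed

lemma compact_set_plus_cball:
  "K \<in> convex_bodies \<Longrightarrow> compact (K + cball 0 \<epsilon>)"
  unfolding set_plus_image using convex_bodiesD[of K]
  by (intro compact_continuous_image compact_Times) (auto intro!: continuous_intros simp: split_beta)

lemma sets_local_parallel_set:
  assumes K: "K \<in> convex_bodies" and \<eta>: "\<eta> \<in> sets normal_bundle_borel"
  shows "local_parallel_set K \<epsilon> \<eta> \<in> sets borel" "bounded (local_parallel_set K \<epsilon> \<eta>)"
proof -
  note K' = convex_bodiesD[OF K]
  have [measurable]: "\<eta> \<in> sets (borel \<Otimes>\<^sub>M borel)"
    unfolding borel_prod by (rule sets_normal_bundle_borel[OF \<eta>])
  have [measurable]: "closest_point K \<in> borel_measurable borel"
    using K' by (intro borel_measurable_continuous_onI continuous_on_closest_point) auto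
  have [measurable]: "K \<in> sets borel" using K' by (intro borel_closed) simp
  have "compact (K + cball 0 \<epsilon>)" by (rule compact_set_plus_cball[OF K])
  then have [measurable]: "K + cball 0 \<epsilon> \<in> sets borel" and b: "bounded (K + cball 0 \<epsilon>)"
    by (auto intro!: borel_closed compact_imp_closed compact_imp_bounded)
  have "local_parallel_set K \<epsilon> \<eta> = ((K + cball 0 \<epsilon>) - K) \<inter>
     ((\<lambda>x. (closest_point K x, sgn (x - closest_point K x))) -` \<eta> \<inter> space borel)"
    by (auto simp: local_parallel_set_def)
  also have "\<dots> \<in> sets borel" by measurable
  finally show "local_parallel_set K \<epsilon> \<eta> \<in> sets borel" .
  show "bounded (local_parallel_set K \<epsilon> \<eta>)"
    by (rule bounded_subset[OF b]) (auto simp: local_parallel_set_def)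
qed

lemma emeasure_local_parallel_set:
  assumes K: "K \<in> C2_plus" and \<epsilon>: "\<epsilon> > 0" and \<eta>: "\<eta> \<in> sets normal_bundle_borel"
  shows "emeasure lborel (local_parallel_set K \<epsilon> \<eta>) =
    (\<integral>\<^sup>+\<phi>. ennreal (\<epsilon> * radius_of_curvature K (unit_vec \<phi>) + \<epsilon>\<^sup>2 / 2) *
       indicator (normal_directions K \<eta>) \<phi> \<partial>lborel)"
proof -
  let ?r = "\<lambda>\<phi>. radius_of_curvature K (unit_vec \<phi>)"
  have Kb: "K \<in> convex_bodies" using K by (simp add: C2_plus_def)
  note [measurable] = measurable_support_point[OF K] measurable_radius_of_curvature[OF K]
    sets_normal_directions[OF K \<eta>]
  define S where "S = {v::real^2. v $ 1 \<in> normal_directions K \<eta> \<and> v $ 2 \<in> {0<..\<epsilon>}}"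
  have [measurable]: "S \<in> sets borel"
    unfolding S_def by measurable
  define A where "A = local_parallel_set K \<epsilon> \<eta>"
  have A: "A \<in> sets borel" "bounded A" using sets_local_parallel_set[OF Kb \<eta>] by (auto simp: A_def)
  have im: "normal_map K ` S = A" unfolding S_def A_def by (rule normal_map_image[OF K \<epsilon>])
  have "A \<in> lmeasurable" using A by (intro bounded_set_imp_lmeasurable) auto
  have "S \<in> sets lebesgue" by simp
  moreover have "inj_on (normal_map K) S"
    by (rule inj_on_subset[OF inj_on_normal_map[OF K]]) (auto simp: S_def normal_directions_def)
  \<comment> \<open>The area formula is an equivalence. The image is already known to be the bounded
    Borel set \<open>A\<close>, so it is read from left to right and yields the integral of the
    Jacobian.\<close>
  ultimately have "normal_map K ` S \<in> lmeasurable \<and> measure lebesgue (normal_map K ` S) = m \<longleftrightarrow>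
    ((\<lambda>v. \<bar>det (matrix (\<lambda>w. (w $ 1 * (?r (v $ 1) + v $ 2)) *\<^sub>R unit_tan (v $ 1)
         + (w $ 2) *\<^sub>R unit_vec (v $ 1)) :: real^2^2)\<bar>) has_integral m) S" for m
    by (intro has_measure_differentiable_image has_derivative_at_withinI[OF normal_map_has_derivative[OF K]])
  then have "((\<lambda>v. \<bar>det (matrix (\<lambda>w. (w $ 1 * (?r (v $ 1) + v $ 2)) *\<^sub>R unit_tan (v $ 1)
         + (w $ 2) *\<^sub>R unit_vec (v $ 1)) :: real^2^2)\<bar>) has_integral measure lebesgue A) S"
    using \<open>A \<in> lmeasurable\<close> unfolding im by blast
  then have "((\<lambda>v. \<bar>?r (v $ 1) + v $ 2\<bar>) has_integral measure lebesgue A) S"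
    unfolding det_normal_map abs_minus_cancel .
  then have "((\<lambda>v. if v \<in> S then \<bar>?r (v $ 1) + v $ 2\<bar> else 0) has_integral measure lebesgue A) UNIV"
    by (simp add: has_integral_restrict_UNIV)
  then have "(\<integral>\<^sup>+v. ennreal (if v \<in> S then \<bar>?r (v $ 1) + v $ 2\<bar> else 0) \<partial>lborel) = measure lebesgue A"
    by (rule nn_integral_has_integral_lborel[rotated 2]) auto
  also have "ennreal (measure lebesgue A) = emeasure lborel A"
    using A emeasure_bounded_finite[of A] by (simp add: emeasure_eq_ennreal_measure less_top)
  finally have "emeasure lborel A = (\<integral>\<^sup>+v. ennreal (if v \<in> S then \<bar>?r (v $ 1) + v $ 2\<bar> else 0) \<partial>lborel)" ..
  also have "\<dots> = (\<integral>\<^sup>+\<phi>. \<integral>\<^sup>+t. ennreal (if vector [\<phi>, t] \<in> S then \<bar>?r \<phi> + t\<bar> else 0) \<partial>lborel \<partial>lborel)"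
    by (subst nn_integral_plane) (auto cong: if_cong)
  also have "\<dots> = (\<integral>\<^sup>+\<phi>. ennreal (\<epsilon> * ?r \<phi> + \<epsilon>\<^sup>2 / 2) * indicator (normal_directions K \<eta>) \<phi> \<partial>lborel)"
  proof (rule nn_integral_cong)
    fix \<phi> :: real
    have r: "?r \<phi> > 0" by (rule radius_of_curvature_pos[OF K])
    have "(\<integral>\<^sup>+t. ennreal (if vector [\<phi>, t] \<in> S then \<bar>?r \<phi> + t\<bar> else 0) \<partial>lborel) =
      (\<integral>\<^sup>+t. indicator (normal_directions K \<eta>) \<phi> * (ennreal (?r \<phi> + t) * indicator {0..\<epsilon>} t) \<partial>lborel)"
    \<comment> \<open>\<open>S\<close> has distances in \<open>{0<..\<epsilon>}\<close>, while the
      fundamental theorem uses the closed interval; the difference \<open>t = 0\<close> is a null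
      set.\<close>
    proof (rule nn_integral_cong_AE, rule eventually_mono[OF AE_lborel_singleton[of 0]])
      fix t :: real assume "t \<noteq> 0"
      then show "ennreal (if vector [\<phi>, t] \<in> S then \<bar>?r \<phi> + t\<bar> else 0) =
        indicator (normal_directions K \<eta>) \<phi> * (ennreal (?r \<phi> + t) * indicator {0..\<epsilon>} t)"
        using r by (cases "\<phi> \<in> normal_directions K \<eta>"; cases "t \<in> {0..\<epsilon>}") (auto simp: S_def)
    qed
    also have "\<dots> = indicator (normal_directions K \<eta>) \<phi> * (\<integral>\<^sup>+t. ennreal (?r \<phi> + t) * indicator {0..\<epsilon>} t \<partial>lborel)"
      by (rule nn_integral_cmult) auto
    also have "(\<integral>\<^sup>+t. ennreal (?r \<phi> + t) * indicator {0..\<epsilon>} t \<partial>lborel) =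
       ennreal ((?r \<phi> * \<epsilon> + \<epsilon>\<^sup>2 / 2) - (?r \<phi> * 0 + 0\<^sup>2 / 2))"
      using r \<epsilon> by (intro nn_integral_FTC_Icc) (auto intro!: derivative_eq_intros)
    finally show "(\<integral>\<^sup>+t. ennreal (if vector [\<phi>, t] \<in> S then \<bar>?r \<phi> + t\<bar> else 0) \<partial>lborel) =
      ennreal (\<epsilon> * ?r \<phi> + \<epsilon>\<^sup>2 / 2) * indicator (normal_directions K \<eta>) \<phi>"
      by (simp add: mult.commute)
  qed
  finally show ?thesis by (simp add: A_def)
qed

section \<open>Support measures as images of densities on the angle\<close>

definition normal_distr :: "(real^2) set \<Rightarrow> (real \<Rightarrow> ennreal) \<Rightarrow> ((real^2) \<times> (real^2)) measure" where
  "normal_distr K f = distr (density lborel (\<lambda>\<phi>. f \<phi> * indicator {0..<2*pi} \<phi>)) normal_bundle_borel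
     (\<lambda>\<phi>. (support_point K \<phi>, unit_vec \<phi>))"

lemma measurable_normal_bundle:
  assumes K: "K \<in> C2_plus"
  shows "(\<lambda>\<phi>. (support_point K \<phi>, unit_vec \<phi>)) \<in> borel \<rightarrow>\<^sub>M normal_bundle_borel"
proof -
  note [measurable] = measurable_support_point[OF K]
  have "(\<lambda>\<phi>. (support_point K \<phi>, unit_vec \<phi>)) \<in> borel \<rightarrow>\<^sub>M (borel \<Otimes>\<^sub>M borel)" by measurable
  then show ?thesis by (intro measurable_restrict_space2) (auto simp: borel_prod)
qed

lemma emeasure_normal_distr:
  assumes K: "K \<in> C2_plus" and [measurable]: "f \<in> borel_measurable borel" and \<eta>: "\<eta> \<in> sets normal_bundle_borel"
  shows "emeasure (normal_distr K f) \<eta> = (\<integral>\<^sup>+\<phi>. f \<phi> * indicator (normal_directions K \<eta>) \<phi> \<partial>lborel)"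
proof -
  note m = measurable_normal_bundle[OF K]
  have "(\<lambda>\<phi>. (support_point K \<phi>, unit_vec \<phi>)) -` \<eta> \<in> sets borel"
    using measurable_sets[OF m \<eta>] by simp
  then show ?thesis
    unfolding normal_distr_def using m \<eta>
    by (subst emeasure_distr)
       (auto simp: emeasure_density normal_directions_def intro!: nn_integral_cong split: split_indicator)
qed

text \<open>The densities come from comparing coefficients:
  \<open>\<epsilon> * r + \<epsilon>\<^sup>2 / 2\<close>, the integral of \<open>r + t\<close> over
  the distances, is \<open>2 * \<epsilon>\<close> times \<open>r / 2\<close> plus
  \<open>pi * \<epsilon>\<^sup>2\<close> times \<open>1 / (2 * pi)\<close>.\<close>

lemma local_Steiner_normal_distr:
  assumes K: "K \<in> C2_plus"
  shows "local_Steiner K (normal_distr K (\<lambda>_. ennreal (1 / (2 * pi))))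
           (normal_distr K (\<lambda>\<phi>. ennreal (radius_of_curvature K (unit_vec \<phi>) / 2)))"
  unfolding local_Steiner_def local_parallel_set_def[symmetric]
proof (intro conjI allI impI ballI)
  fix \<epsilon> :: real and \<eta> assume \<epsilon>: "0 < \<epsilon>" and \<eta>: "\<eta> \<in> sets normal_bundle_borel"
  let ?r = "\<lambda>\<phi>. radius_of_curvature K (unit_vec \<phi>)"
  note [measurable] = measurable_radius_of_curvature[OF K] sets_normal_directions[OF K \<eta>]
  have r: "?r \<phi> > 0" for \<phi> by (rule radius_of_curvature_pos[OF K])
  have "ennreal (\<epsilon> * ?r \<phi> + \<epsilon>\<^sup>2 / 2) = ennreal (2 * \<epsilon>) * ennreal (?r \<phi> / 2) +
      ennreal (pi * \<epsilon>\<^sup>2) * ennreal (1 / (2 * pi))" for \<phi>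
    using \<epsilon> r[of \<phi>] by (simp flip: ennreal_mult ennreal_plus)
  then have "emeasure lborel (local_parallel_set K \<epsilon> \<eta>) =
    (\<integral>\<^sup>+\<phi>. ennreal (2 * \<epsilon>) * (ennreal (?r \<phi> / 2) * indicator (normal_directions K \<eta>) \<phi>) +
      ennreal (pi * \<epsilon>\<^sup>2) * (ennreal (1 / (2 * pi)) * indicator (normal_directions K \<eta>) \<phi>) \<partial>lborel)"
    unfolding emeasure_local_parallel_set[OF K \<epsilon> \<eta>]
    by (intro nn_integral_cong) (simp only: distrib_right mult.assoc)
  also have "\<dots> = ennreal (2 * \<epsilon>) * (\<integral>\<^sup>+\<phi>. ennreal (?r \<phi> / 2) * indicator (normal_directions K \<eta>) \<phi> \<partial>lborel) +
     ennreal (pi * \<epsilon>\<^sup>2) * (\<integral>\<^sup>+\<phi>. ennreal (1 / (2 * pi)) * indicator (normal_directions K \<eta>) \<phi> \<partial>lborel)"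
    by (subst nn_integral_add; (subst nn_integral_cmult)?; (subst nn_integral_cmult)?; measurable)
  finally show "emeasure lborel (local_parallel_set K \<epsilon> \<eta>) =
       ennreal (2 * \<epsilon>) * emeasure (normal_distr K (\<lambda>\<phi>. ennreal (?r \<phi> / 2))) \<eta> +
       ennreal (pi * \<epsilon>\<^sup>2) * emeasure (normal_distr K (\<lambda>_. ennreal (1 / (2 * pi)))) \<eta>"
    by (simp add: emeasure_normal_distr[OF K _ \<eta>])
qed (simp_all add: normal_distr_def)

text \<open>Four times the equation at radius 1 minus the equation at radius 2 eliminates
  \<open>b\<close> and \<open>b'\<close>. Finiteness permits the passage to real numbers, where
  terms can be cancelled.\<close>

lemma linear_system_unique:
  fixes a a' b b' :: ennreal
  assumes "\<And>\<epsilon>::real. \<epsilon> > 0 \<Longrightarrow> ennreal (2 * \<epsilon>) * a + ennreal (pi * \<epsilon>\<^sup>2) * b = ennreal (2 * \<epsilon>) * a' + ennreal (pi * \<epsilon>\<^sup>2) * b'"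
    and "\<And>\<epsilon>::real. \<epsilon> > 0 \<Longrightarrow> ennreal (2 * \<epsilon>) * a + ennreal (pi * \<epsilon>\<^sup>2) * b < \<infinity>"
  shows "a = a'"
proof -
  have fin: "ennreal 2 * a + ennreal pi * b < \<infinity>" "ennreal 2 * a' + ennreal pi * b' < \<infinity>"
    using assms[of 1] by auto
  then have "a \<noteq> top" "b \<noteq> top" "a' \<noteq> top" "b' \<noteq> top"
    by (auto simp: ennreal_mult_less_top less_top[symmetric] ennreal_mult_eq_top_iff)
  then obtain x y x' y' where x: "a = ennreal x" "b = ennreal y" "a' = ennreal x'" "b' = ennreal y'"
    and nn: "0 \<le> x" "0 \<le> y" "0 \<le> x'" "0 \<le> y'"
    by (metis ennreal_cases)
  have *: "2 * \<epsilon> * x + pi * \<epsilon>\<^sup>2 * y = 2 * \<epsilon> * x' + pi * \<epsilon>\<^sup>2 * y'" if "\<epsilon> > 0" for \<epsilon>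
  proof -
    have "ennreal (2 * \<epsilon> * x + pi * \<epsilon>\<^sup>2 * y) = ennreal (2 * \<epsilon> * x' + pi * \<epsilon>\<^sup>2 * y')"
      using assms(1)[OF that] that nn by (simp add: x ennreal_plus ennreal_mult)
    then show ?thesis using that nn by (subst (asm) ennreal_inj) auto
  qed
  have "x = x'" using *[of 1] *[of 2] by (simp add: algebra_simps)
  then show ?thesis by (simp add: x)
qed

text \<open>For \<open>THE\<close>, uniqueness is checked set by set: local parallel sets are
  bounded, so their areas are finite, and \<open>linear_system_unique\<close> isolates the linear
  coefficient whatever \<open>\<Lambda>0\<close> accompanies it.\<close>

lemma support_measure1_C2_plus:
  assumes K: "K \<in> C2_plus"
  shows "support_measure1 K = normal_distr K (\<lambda>\<phi>. ennreal (radius_of_curvature K (unit_vec \<phi>) / 2))"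
  unfolding support_measure1_def
proof (rule the_equality)
  let ?L0 = "normal_distr K (\<lambda>_. ennreal (1 / (2 * pi)))"
    and ?L1 = "normal_distr K (\<lambda>\<phi>. ennreal (radius_of_curvature K (unit_vec \<phi>) / 2))"
  note LS = local_Steiner_normal_distr[OF K]
  have Kb: "K \<in> convex_bodies" using K by (simp add: C2_plus_def)
  show "\<exists>\<Lambda>0. local_Steiner K \<Lambda>0 ?L1" using LS by blast
  fix L1 assume "\<exists>\<Lambda>0. local_Steiner K \<Lambda>0 L1"
  then obtain L0 where L: "local_Steiner K L0 L1" ..
  show "L1 = ?L1"
  proof (rule measure_eqI)
    show "sets L1 = sets ?L1" using L LS by (simp add: local_Steiner_def)
    fix \<eta> assume "\<eta> \<in> sets L1"
    then have \<eta>: "\<eta> \<in> sets normal_bundle_borel" using L by (simp add: local_Steiner_def)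
    have fin: "emeasure lborel (local_parallel_set K \<epsilon> \<eta>) < \<infinity>" for \<epsilon>
      using sets_local_parallel_set(2)[OF Kb \<eta>] by (rule emeasure_bounded_finite)
    have eq: "emeasure lborel (local_parallel_set K \<epsilon> \<eta>) =
        ennreal (2 * \<epsilon>) * emeasure L1 \<eta> + ennreal (pi * \<epsilon>\<^sup>2) * emeasure L0 \<eta>"
      and eq': "emeasure lborel (local_parallel_set K \<epsilon> \<eta>) =
        ennreal (2 * \<epsilon>) * emeasure ?L1 \<eta> + ennreal (pi * \<epsilon>\<^sup>2) * emeasure ?L0 \<eta>" if "\<epsilon> > 0" for \<epsilon>
      using L LS \<eta> that unfolding local_Steiner_def local_parallel_set_def by blast+
    show "emeasure L1 \<eta> = emeasure ?L1 \<eta>"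
    proof (rule linear_system_unique[of _ "emeasure L0 \<eta>" _ "emeasure ?L0 \<eta>"])
      fix \<epsilon> :: real assume "\<epsilon> > 0"
      then show "ennreal (2 * \<epsilon>) * emeasure L1 \<eta> + ennreal (pi * \<epsilon>\<^sup>2) * emeasure L0 \<eta> =
        ennreal (2 * \<epsilon>) * emeasure ?L1 \<eta> + ennreal (pi * \<epsilon>\<^sup>2) * emeasure ?L0 \<eta>"
        using eq eq' by metis
      show "ennreal (2 * \<epsilon>) * emeasure L1 \<eta> + ennreal (pi * \<epsilon>\<^sup>2) * emeasure L0 \<eta> < \<infinity>"
        using eq[OF \<open>\<epsilon> > 0\<close>] fin[of \<epsilon>] by simp
    qed
  qed
qed

subsection \<open>Finite measures on the circle are determined by their tensor moments\<close>

lemma tensor_power_length [simp]: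
  "tensor_power (length is) x is = (\<Prod>i\<leftarrow>is. x $ i)"
  by (simp add: tensor_power_def)

lemma continuous_on_prod_list_nth [continuous_intros]:
  "continuous_on S f \<Longrightarrow> continuous_on S (\<lambda>y. \<Prod>i\<leftarrow>is. (f y :: real^2) $ i)"
  by (induction "is") (auto intro!: continuous_intros)

text \<open>Linear combinations of tensor power coordinates, with monomials indexed by lists as in
  \<open>tensor_power\<close>; the link between polynomial approximation and the given
  moments.\<close>

inductive tensor_polynomial :: "(real^2 \<Rightarrow> real) \<Rightarrow> bool" where
  monomial: "tensor_polynomial (\<lambda>x. c * (\<Prod>i\<leftarrow>is. x $ i))"
| add: "tensor_polynomial f \<Longrightarrow> tensor_polynomial g \<Longrightarrow> tensor_polynomial (\<lambda>x. f x + g x)"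

text \<open>Monomials multiply by concatenating their index lists; sums follow by
  distributivity.\<close>

lemma tensor_polynomial_mult:
  assumes "tensor_polynomial f" "tensor_polynomial g"
  shows "tensor_polynomial (\<lambda>x. f x * g x)"
  using assms
proof (induction f rule: tensor_polynomial.induct)
  case (monomial c "is")
  from \<open>tensor_polynomial g\<close> show ?case
  proof (induction g rule: tensor_polynomial.induct)
    case (monomial d js)
    show ?case
      using tensor_polynomial.monomial[of "c * d" "is @ js"] by (simp add: ac_simps)
  qed (simp add: distrib_left tensor_polynomial.add)
qed (simp add: distrib_right tensor_polynomial.add)

text \<open>Constants come from the empty list, linear functions from the lists \<open>[1]\<close>
  and \<open>[2]\<close>.\<close>

lemma real_polynomial_function_imp_tensor_polynomial:
  "real_polynomial_function f \<Longrightarrow> tensor_polynomial f"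
proof (induction f rule: real_polynomial_function.induct)
  case (linear f)
  interpret bounded_linear f by fact
  have "x = (x $ 1) *\<^sub>R axis 1 1 + (x $ 2) *\<^sub>R axis 2 1" for x :: "real^2"
    by (simp add: vec2_eq_iff axis_def)
  then have "f x = (x $ 1) *\<^sub>R f (axis 1 1) + (x $ 2) *\<^sub>R f (axis 2 1)" for x
    by (metis add scaleR)
  then obtain a b where "\<And>x. f x = (x $ 1) *\<^sub>R a + (x $ 2) *\<^sub>R b" by blast
  then have "f = (\<lambda>x. a * (\<Prod>i\<leftarrow>[1]. x $ i) + b * (\<Prod>i\<leftarrow>[2]. x $ i))"
    by (simp add: fun_eq_iff mult.commute)
  then show ?case
    by (simp only: tensor_polynomial.add tensor_polynomial.monomial)
next
  case (const c)
  show ?case using tensor_polynomial.monomial[of c "[]"] by simp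
qed (auto intro: tensor_polynomial.add tensor_polynomial_mult)

section \<open>From moments to measures on the circle\<close>

lemma integrable_continuous_unit_vec:
  fixes f :: "real^2 \<Rightarrow> real"
  assumes "finite_measure M" and sets: "sets M = sets borel" and f: "continuous_on UNIV f"
  shows "integrable M (\<lambda>\<phi>. f (unit_vec \<phi>))"
proof -
  interpret finite_measure M by fact
  have "bounded (f ` sphere 0 1)"
    by (intro compact_imp_bounded compact_continuous_image continuous_on_subset[OF f]) auto
  then obtain B where "\<forall>x\<in>sphere 0 1. norm (f x) \<le> B"
    by (auto simp: bounded_iff)
  then have B: "norm x = 1 \<Longrightarrow> \<bar>f x\<bar> \<le> B" for x
    by simp
  have "(\<lambda>\<phi>. f (unit_vec \<phi>)) \<in> borel_measurable borel"
    by (intro borel_measurable_continuous_onI continuous_on_compose2[OF f] continuous_intros) auto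
  then have "(\<lambda>\<phi>. f (unit_vec \<phi>)) \<in> borel_measurable M"
    using measurable_cong_sets[OF sets refl] by blast
  then show ?thesis
    by (rule integrable_const_bound[rotated, where B=B]) (simp add: B)
qed

lemma tensor_polynomial_continuous: "tensor_polynomial f \<Longrightarrow> continuous_on S f"
  by (induction f rule: tensor_polynomial.induct) (auto intro!: continuous_intros)

text \<open>Replacing \<open>f\<close> by a polynomial \<open>g\<close> uniformly close on the
  circle changes each integral by at most the error times the mass, and the integrals of
  \<open>g\<close> agree by the moment hypothesis.\<close>

lemma integral_continuous_eq_of_moments:
  fixes M N :: "real measure" and f :: "real^2 \<Rightarrow> real"
  assumes fin: "finite_measure M" "finite_measure N"
    and sets: "sets M = sets borel" "sets N = sets borel"
    and eq: "\<And>is. (\<integral>\<phi>. (\<Prod>i\<leftarrow>is. unit_vec \<phi> $ i) \<partial>M) = (\<integral>\<phi>. (\<Prod>i\<leftarrow>is. unit_vec \<phi> $ i) \<partial>N)"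
    and f: "continuous_on UNIV f"
  shows "(\<integral>\<phi>. f (unit_vec \<phi>) \<partial>M) = (\<integral>\<phi>. f (unit_vec \<phi>) \<partial>N)"
proof (rule ccontr)
  let ?I = "\<lambda>M g. \<integral>\<phi>. g (unit_vec \<phi>) \<partial>M"
  note int = integrable_continuous_unit_vec[OF fin(1) sets(1)] integrable_continuous_unit_vec[OF fin(2) sets(2)]
  assume ne: "?I M f \<noteq> ?I N f"
  define m where "m = measure M UNIV + measure N UNIV"
  \<comment> \<open>The two errors add up to at most \<open>e * m\<close>, which must stay below the
    gap \<open>e * (2 * (m + 1))\<close>; the \<open>+ 1\<close> keeps the denominator
    positive.\<close>
  define e where "e = \<bar>?I M f - ?I N f\<bar> / (2 * (m + 1))"
  have m: "m \<ge> 0" by (simp add: m_def)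
  then have "e > 0" using ne by (simp add: e_def)
  obtain g where g: "real_polynomial_function g" "\<And>x. x \<in> sphere 0 1 \<Longrightarrow> \<bar>f x - g x\<bar> < e"
    by (rule Stone_Weierstrass_real_polynomial_function[OF compact_sphere[of 0 1]
          continuous_on_subset[OF f subset_UNIV] \<open>e > 0\<close>]) (rule that)
  have tp: "tensor_polynomial g" using g(1) by (rule real_polynomial_function_imp_tensor_polynomial)
  then have Ig: "?I M g = ?I N g"
  proof (induction g rule: tensor_polynomial.induct)
    case (monomial c "is")
    then show ?case using eq by simp
  next
    case (add f g)
    then show ?case
      using int(1)[OF tensor_polynomial_continuous[OF add.hyps(1)]] int(1)[OF tensor_polynomial_continuous[OF add.hyps(2)]]
        int(2)[OF tensor_polynomial_continuous[OF add.hyps(1)]] int(2)[OF tensor_polynomial_continuous[OF add.hyps(2)]]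
      by simp
  qed
  have *: "\<bar>?I L f - ?I L g\<bar> \<le> e * measure L UNIV"
    if L: "finite_measure L" "sets L = sets borel" for L
  proof -
    interpret L: finite_measure L by fact
    have sp: "space L = UNIV" using sets_eq_imp_space_eq[OF L(2)] by simp
    have "\<bar>?I L f - ?I L g\<bar> = \<bar>\<integral>\<phi>. f (unit_vec \<phi>) - g (unit_vec \<phi>) \<partial>L\<bar>"
      by (subst Bochner_Integration.integral_diff) (intro integrable_continuous_unit_vec[OF L] f tensor_polynomial_continuous[OF tp] refl)+
    also have "\<dots> \<le> (\<integral>\<phi>. \<bar>f (unit_vec \<phi>) - g (unit_vec \<phi>)\<bar> \<partial>L)"
      by (rule integral_abs_bound)
    also have "\<dots> \<le> (\<integral>\<phi>. e \<partial>L)"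
    proof (rule integral_mono)
      show "integrable L (\<lambda>\<phi>. \<bar>f (unit_vec \<phi>) - g (unit_vec \<phi>)\<bar>)"
        by (intro integrable_abs Bochner_Integration.integrable_diff
            integrable_continuous_unit_vec[OF L] f tensor_polynomial_continuous[OF tp])
    qed (use g(2) in \<open>auto intro!: less_imp_le\<close>)
    also have "\<dots> = e * measure L UNIV" by (simp add: sp)
    finally show ?thesis .
  qed
  have "\<bar>?I M f - ?I N f\<bar> \<le> e * m"
    using *[OF fin(1) sets(1)] *[OF fin(2) sets(2)] Ig by (simp add: m_def distrib_left)
  also have "e * m < e * (2 * (m + 1))" using \<open>e > 0\<close> m by simp
  also have "\<dots> = \<bar>?I M f - ?I N f\<bar>"
  proof -
    have "0 < 2 * (m + 1)" using m by simp
    then show ?thesis using e_def by (metis nonzero_eq_divide_eq less_irrefl)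
  qed
  finally show False by simp
qed

text \<open>The continuous functions \<open>f n\<close> equal 1 on \<open>F\<close> and, for
  \<open>n > 0\<close>, vanish at distance at least \<open>1 / n\<close>, so they tend to the
  indicator of the closed set \<open>F\<close>, dominated by 1. \<open>F\<close> is nonempty since
  \<open>infdist\<close> to the empty set is 0 by convention.\<close>

lemma measure_vimage_unit_vec_eq_of_moments:
  fixes M N :: "real measure"
  assumes fin: "finite_measure M" "finite_measure N"
    and sets: "sets M = sets borel" "sets N = sets borel"
    and eq: "\<And>is. (\<integral>\<phi>. (\<Prod>i\<leftarrow>is. unit_vec \<phi> $ i) \<partial>M) = (\<integral>\<phi>. (\<Prod>i\<leftarrow>is. unit_vec \<phi> $ i) \<partial>N)"
    and F: "closed F" "F \<noteq> {}"
  shows "measure M (unit_vec -` F) = measure N (unit_vec -` F)"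
proof -
  define f where "f n x = max 0 (1 - real n * infdist x F)" for n and x :: "real^2"
  have f: "continuous_on UNIV (f n)" for n
    unfolding f_def by (intro continuous_intros)
  have "(\<lambda>n. f n x) \<longlonglongrightarrow> indicator F x" for x
  proof (cases "x \<in> F")
    case True
    then show ?thesis by (simp add: f_def)
  next
    case False
    then have "infdist x F > 0" using F in_closed_iff_infdist_zero[of F x] infdist_nonneg[of x F] by auto
    then obtain k where k: "real k * infdist x F > 1" using reals_Archimedean3 by blast
    have "\<forall>\<^sub>F n in sequentially. f n x = 0"
      using eventually_ge_at_top[of k]
    proof eventually_elim
      case (elim n)
      then have "real k * infdist x F \<le> real n * infdist x F"
        by (intro mult_right_mono infdist_nonneg) simp
      then show ?case using k by (simp add: f_def)
    qed
    then show ?thesis using False by (simp add: tendsto_eventually)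
  qed
  from this[of "unit_vec _"]
  have lim: "(\<lambda>n. f n (unit_vec \<phi>)) \<longlonglongrightarrow> indicator (unit_vec -` F) \<phi>" for \<phi>
    by (simp only: indicator_def vimage_eq)
  have vF: "unit_vec -` F \<in> sets borel"
    using F(1) by (intro borel_closed closed_vimage) (auto intro!: continuous_intros)
  have "(\<lambda>n. \<integral>\<phi>. f n (unit_vec \<phi>) \<partial>L) \<longlonglongrightarrow> measure L (unit_vec -` F)"
    if L: "finite_measure L" "sets L = sets borel" for L
  proof -
    interpret L: finite_measure L by fact
    have sp: "space L = UNIV" using sets_eq_imp_space_eq[OF L(2)] by simp
    have "(\<lambda>n. \<integral>\<phi>. f n (unit_vec \<phi>) \<partial>L) \<longlonglongrightarrow> (\<integral>\<phi>. indicator (unit_vec -` F) \<phi> \<partial>L)"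
    proof (rule integral_dominated_convergence[where w="\<lambda>_. 1"])
      show "indicator (unit_vec -` F) \<in> borel_measurable L"
        using vF L(2) by simp
      show "(\<lambda>\<phi>. f n (unit_vec \<phi>)) \<in> borel_measurable L" for n
        using integrable_continuous_unit_vec[OF L f] by (rule borel_measurable_integrable)
      show "AE \<phi> in L. (\<lambda>n. f n (unit_vec \<phi>)) \<longlonglongrightarrow> indicator (unit_vec -` F) \<phi>"
        using lim by simp
      show "AE \<phi> in L. norm (f n (unit_vec \<phi>)) \<le> 1" for n
        by (simp add: f_def infdist_nonneg)
    qed simp
    then show ?thesis using vF L(2) by (simp add: sp)
  qed
  from LIMSEQ_unique[OF this[OF fin(1) sets(1)]] this[OF fin(2) sets(2)]
  show ?thesis
    using integral_continuous_eq_of_moments[OF fin sets eq f] by simp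
qed

text \<open>Distribution functions are compared: up to a null set \<open>{..x}\<close> is the
  preimage of the closed arc with angles in \<open>{0..x}\<close>. Angles are unique in the
  half-open period, so nothing wraps around.\<close>

lemma circle_measure_eq_of_moments:
  fixes M N :: "real measure"
  assumes fin: "finite_measure M" "finite_measure N"
    and sets: "sets M = sets borel" "sets N = sets borel"
    and AE: "AE \<phi> in M. \<phi> \<in> {0..<2*pi}" "AE \<phi> in N. \<phi> \<in> {0..<2*pi}"
    and eq: "\<And>is. (\<integral>\<phi>. (\<Prod>i\<leftarrow>is. unit_vec \<phi> $ i) \<partial>M) = (\<integral>\<phi>. (\<Prod>i\<leftarrow>is. unit_vec \<phi> $ i) \<partial>N)"
  shows "M = N"
proof -
  have sp: "space M = UNIV" "space N = UNIV" using sets_eq_imp_space_eq[of _ borel] sets by auto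
  have tot: "measure M UNIV = measure N UNIV"
    using measure_vimage_unit_vec_eq_of_moments[OF fin sets eq, of UNIV] by simp
  have at: "measure M {..x} = measure N {..x}" for x
  proof -
    \<comment> \<open>All mass sits on \<open>{0..<2*pi}\<close>, so the outer cases give 0 and the
      total mass, which is the same for both measures by \<open>tot\<close>.\<close>
    consider "x < 0" | "0 \<le> x" "x < 2 * pi" | "x \<ge> 2 * pi" by linarith
    then show ?thesis
    proof cases
      case 1
      have "measure L {..x} = measure L {}" if L: "sets L = sets borel" "AE \<phi> in L. \<phi> \<in> {0..<2*pi}" for L
      proof (rule measure_eq_AE)
        show "AE \<phi> in L. \<phi> \<in> {..x} \<longleftrightarrow> \<phi> \<in> {}"
          using L(2) by eventually_elim (use 1 in auto)
      qed (use L(1) in auto)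
      then show ?thesis using sets AE by simp
    next
      case 3
      have "measure L {..x} = measure L UNIV" if L: "sets L = sets borel" "AE \<phi> in L. \<phi> \<in> {0..<2*pi}" for L
      proof (rule measure_eq_AE)
        show "AE \<phi> in L. \<phi> \<in> {..x} \<longleftrightarrow> \<phi> \<in> UNIV"
          using L(2) by eventually_elim (use 3 in auto)
      qed (use L(1) in auto)
      then show ?thesis using sets AE tot by simp
    next
      case 2
      define F where "F = unit_vec ` {0..x}"
      have F: "closed F" "F \<noteq> {}"
        using 2 by (auto simp: F_def intro!: compact_imp_closed compact_continuous_image continuous_intros)
      have iff: "unit_vec \<phi> \<in> F \<longleftrightarrow> \<phi> \<le> x" if "\<phi> \<in> {0..<2*pi}" for \<phi>
      proof -
        have "{0..x} \<subseteq> {0..<2*pi}" using 2 by auto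
        from inj_on_image_mem_iff[OF inj_on_unit_vec that this] show ?thesis
          using that by (simp add: F_def)
      qed
      have "unit_vec -` F \<in> sets borel"
        using F(1) by (intro borel_closed closed_vimage) (auto intro!: continuous_intros)
      then have "measure L {..x} = measure L (unit_vec -` F)"
        if L: "sets L = sets borel" "AE \<phi> in L. \<phi> \<in> {0..<2*pi}" for L
      proof (intro measure_eq_AE)
        show "AE \<phi> in L. \<phi> \<in> {..x} \<longleftrightarrow> \<phi> \<in> unit_vec -` F"
          using L(2) by eventually_elim (simp add: iff)
      qed (use L(1) in auto)
      then show ?thesis using sets AE measure_vimage_unit_vec_eq_of_moments[OF fin sets eq F] by simp
    qed
  qed
  show ?thesis
  proof (rule measure_eqI_lessThan[OF sets])
    interpret M: finite_measure M by fact
    interpret N: finite_measure N by fact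
    fix x :: real
    show "emeasure M {x<..} < \<infinity>" by (simp add: less_top[symmetric])
    have eq': "{x<..} = UNIV - {..x}" by auto
    show "emeasure M {x<..} = emeasure N {x<..}"
      using M.finite_measure_compl[of "{..x}"] N.finite_measure_compl[of "{..x}"] at[of x] tot sets
      by (simp add: M.emeasure_eq_measure N.emeasure_eq_measure sp eq')
  qed
qed

subsection \<open>Surface tensors of bodies with positive curvature\<close>

text \<open>The integrand sees only the normal, so after transport to the angles the support point
  disappears and the density \<open>r / 2\<close> of the support measure remains.\<close>

lemma surface_tensor_C2_plus:
  assumes K: "K \<in> C2_plus"
  shows "surface_tensor (length is) K is =
    1 / fact (length is) * (sphere_surface 1 / sphere_surface (1 + length is)) *
    (\<integral>\<phi>. (radius_of_curvature K (unit_vec \<phi>) / 2 * indicator {0..<2*pi} \<phi>) *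
        (\<Prod>i\<leftarrow>is. unit_vec \<phi> $ i) \<partial>lborel)"
proof -
  let ?r = "\<lambda>\<phi>. radius_of_curvature K (unit_vec \<phi>)"
  note [measurable] = measurable_normal_bundle[OF K] measurable_radius_of_curvature[OF K]
  have [measurable]: "(\<lambda>z. \<Prod>i\<leftarrow>is. snd z $ i) \<in> borel_measurable normal_bundle_borel"
    by (intro measurable_restrict_space1 borel_measurable_continuous_onI continuous_intros)
  have [measurable]: "(\<lambda>\<phi>. \<Prod>i\<leftarrow>is. unit_vec \<phi> $ i) \<in> borel_measurable borel"
    by (intro borel_measurable_continuous_onI continuous_intros)
  have r: "0 \<le> ?r \<phi>" for \<phi> using radius_of_curvature_pos[OF K, of \<phi>] by simp
  have "(\<integral>z. (\<Prod>i\<leftarrow>is. snd z $ i) \<partial>support_measure1 K) =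
     (\<integral>\<phi>. (\<Prod>i\<leftarrow>is. unit_vec \<phi> $ i)
       \<partial>density lborel (\<lambda>\<phi>. ennreal (?r \<phi> / 2) * indicator {0..<2*pi} \<phi>))"
    unfolding support_measure1_C2_plus[OF K] normal_distr_def
    by (subst integral_distr) simp_all
  also have "(\<lambda>\<phi>. ennreal (?r \<phi> / 2) * indicator {0..<2*pi} \<phi>) =
      (\<lambda>\<phi>. ennreal (?r \<phi> / 2 * indicator {0..<2*pi} \<phi>))"
    by (auto split: split_indicator)
  also have "(\<integral>\<phi>. (\<Prod>i\<leftarrow>is. unit_vec \<phi> $ i) \<partial>density lborel \<dots>) =
      (\<integral>\<phi>. (?r \<phi> / 2 * indicator {0..<2*pi} \<phi>) *\<^sub>R (\<Prod>i\<leftarrow>is. unit_vec \<phi> $ i) \<partial>lborel)"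
    using r by (intro integral_density) auto
  finally show ?thesis
    by (simp only: surface_tensor_def tensor_power_length real_scaleR_def)
qed

text \<open>Radius 1 and all normals in the area formula, with \<open>r \<le> r + 1 / 2\<close>. The
  bound is the quantity that \<open>grain_distribution\<close> controls in mean.\<close>

lemma nn_integral_radius_of_curvature_le:
  assumes K: "K \<in> C2_plus"
  shows "(\<integral>\<^sup>+\<phi>. ennreal (radius_of_curvature K (unit_vec \<phi>)) * indicator {0..<2*pi} \<phi> \<partial>lborel)
     \<le> emeasure lborel (K + cball 0 1)"
proof -
  let ?\<eta> = "UNIV \<times> sphere 0 1 :: ((real^2) \<times> (real^2)) set"
  have Kb: "K \<in> convex_bodies" using K by (simp add: C2_plus_def)
  have \<eta>: "?\<eta> \<in> sets normal_bundle_borel"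
    using sets.top[of normal_bundle_borel] by (simp add: space_restrict_space)
  have "normal_directions K ?\<eta> = {0..<2*pi}" by (auto simp: normal_directions_def)
  moreover have "radius_of_curvature K (unit_vec \<phi>) \<le> 1 * radius_of_curvature K (unit_vec \<phi>) + 1\<^sup>2 / 2" for \<phi>
    by simp
  ultimately have "(\<integral>\<^sup>+\<phi>. ennreal (radius_of_curvature K (unit_vec \<phi>)) * indicator {0..<2*pi} \<phi> \<partial>lborel)
     \<le> emeasure lborel (local_parallel_set K 1 ?\<eta>)"
    unfolding emeasure_local_parallel_set[OF K zero_less_one \<eta>]
    by (intro nn_integral_mono) (auto split: split_indicator intro!: ennreal_leI)
  also have "\<dots> \<le> emeasure lborel (K + cball 0 1)"
  proof (rule emeasure_mono)
    show "K + cball 0 1 \<in> sets lborel"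
      using compact_set_plus_cball[OF Kb] by (simp add: borel_closed compact_imp_closed)
  qed (auto simp: local_parallel_set_def)
  finally show ?thesis .
qed

subsection \<open>The support function\<close>

definition support_fun :: "(real^2) set \<Rightarrow> real \<Rightarrow> real" where
  "support_fun K \<phi> = (SUP y\<in>K. y \<bullet> unit_vec \<phi>)"

lemma inner_le_support_fun:
  assumes "K \<in> convex_bodies" "y \<in> K"
  shows "y \<bullet> unit_vec \<phi> \<le> support_fun K \<phi>"
proof -
  have "compact ((\<lambda>y. y \<bullet> unit_vec \<phi>) ` K)"
    using convex_bodiesD[OF assms(1)] by (intro compact_continuous_image continuous_intros) auto
  then have "bdd_above ((\<lambda>y. y \<bullet> unit_vec \<phi>) ` K)"
    by (intro bounded_imp_bdd_above compact_imp_bounded)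
  then show ?thesis unfolding support_fun_def using assms(2) by (intro cSUP_upper)
qed

lemma support_fun_le:
  assumes "K \<in> convex_bodies" "\<And>y. y \<in> K \<Longrightarrow> y \<bullet> unit_vec \<phi> \<le> c"
  shows "support_fun K \<phi> \<le> c"
  unfolding support_fun_def using assms convex_bodiesD[OF assms(1)] by (intro cSUP_least) auto

lemma support_fun_C2_plus:
  assumes K: "K \<in> C2_plus"
  shows "support_fun K \<phi> = support_point K \<phi> \<bullet> unit_vec \<phi>"
proof (rule antisym)
  have Kb: "K \<in> convex_bodies" using K by (simp add: C2_plus_def)
  have sp: "support_point K \<phi> \<in> K" "\<And>y. y \<in> K \<Longrightarrow> (y - support_point K \<phi>) \<bullet> unit_vec \<phi> \<le> 0"
    using outer_normal_at_support_point[OF K, of \<phi>] convex_bodiesD[OF Kb]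
    by (auto simp: outer_normal_at_iff)
  show "support_fun K \<phi> \<le> support_point K \<phi> \<bullet> unit_vec \<phi>"
    using sp(2) by (intro support_fun_le[OF Kb]) (simp add: inner_diff_left)
  show "support_point K \<phi> \<bullet> unit_vec \<phi> \<le> support_fun K \<phi>"
    by (rule inner_le_support_fun[OF Kb sp(1)])
qed

text \<open>Lipschitz in the chord distance of the unit vectors, with a norm bound on
  \<open>K\<close> as constant.\<close>

lemma continuous_on_support_fun:
  assumes K: "K \<in> convex_bodies"
  shows "continuous_on UNIV (support_fun K)"
proof -
  obtain R where R: "\<And>y. y \<in> K \<Longrightarrow> norm y \<le> R"
    using convex_bodiesD[OF K] by (auto simp: bounded_iff)
  have le: "support_fun K \<phi> - support_fun K \<psi> \<le> R * dist (unit_vec \<phi>) (unit_vec \<psi>)" for \<phi> \<psi>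
  proof -
    have "y \<bullet> unit_vec \<phi> \<le> support_fun K \<psi> + R * dist (unit_vec \<phi>) (unit_vec \<psi>)" if "y \<in> K" for y
    proof -
      have "y \<bullet> unit_vec \<phi> = y \<bullet> unit_vec \<psi> + y \<bullet> (unit_vec \<phi> - unit_vec \<psi>)"
        by (simp add: inner_diff_right)
      also have "y \<bullet> (unit_vec \<phi> - unit_vec \<psi>) \<le> norm y * norm (unit_vec \<phi> - unit_vec \<psi>)"
        by (rule norm_cauchy_schwarz)
      also have "\<dots> \<le> R * dist (unit_vec \<phi>) (unit_vec \<psi>)"
        using R[OF that] by (simp add: dist_norm mult_right_mono)
      finally show ?thesis using inner_le_support_fun[OF K that, of \<psi>] by simp
    qed
    then have "support_fun K \<phi> \<le> support_fun K \<psi> + R * dist (unit_vec \<phi>) (unit_vec \<psi>)"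
      by (rule support_fun_le[OF K])
    then show ?thesis by simp
  qed
  have "(support_fun K \<longlongrightarrow> support_fun K \<psi>) (at \<psi>)" for \<psi>
  proof (rule Lim_null_comparison[THEN Lim_null[THEN iffD2]])
    show "\<forall>\<^sub>F \<phi> in at \<psi>. norm (support_fun K \<phi> - support_fun K \<psi>) \<le> R * dist (unit_vec \<phi>) (unit_vec \<psi>)"
      using le by (intro always_eventually allI) (simp add: abs_le_iff, metis dist_commute)
    have "(unit_vec \<longlongrightarrow> unit_vec \<psi>) (at \<psi>)"
      using continuous_on_unit_vec[OF continuous_on_id, of UNIV]
      by (simp add: continuous_on_eq_continuous_at isCont_def)
    then have "((\<lambda>\<phi>. R * dist (unit_vec \<phi>) (unit_vec \<psi>)) \<longlongrightarrow> R * dist (unit_vec \<psi>) (unit_vec \<psi>)) (at \<psi>)"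
      by (intro tendsto_intros)
    then show "((\<lambda>\<phi>. R * dist (unit_vec \<phi>) (unit_vec \<psi>)) \<longlongrightarrow> 0) (at \<psi>)" by simp
  qed
  then show ?thesis by (simp add: continuous_on_def)
qed

section \<open>The support function and the Borel sets of the Hausdorff distance\<close>

lemma space_convex_body_borel [simp]: "space convex_body_borel = convex_bodies"
  unfolding convex_body_borel_def by (rule space_measure_of) auto

lemma sets_convex_body_borelI:
  assumes "U \<subseteq> convex_bodies"
    "\<And>K. K \<in> U \<Longrightarrow> \<exists>e>0. \<forall>L\<in>convex_bodies. hausdorff_dist K L < e \<longrightarrow> L \<in> U"
  shows "U \<in> sets convex_body_borel"
  unfolding convex_body_borel_def using assms by (intro in_measure_of) auto

text \<open>An infimum below \<open>e\<close> yields a member below \<open>e\<close> once the set is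
  nonempty; a bound \<open>R\<close> on all distances within \<open>K \<union> L\<close> is a
  member. The inclusion kept is the one that bounds \<open>support_fun L\<close> from above.\<close>

lemma hausdorff_dist_lessE:
  assumes "K \<in> convex_bodies" "L \<in> convex_bodies" "hausdorff_dist K L < e"
  obtains \<epsilon> where "0 \<le> \<epsilon>" "\<epsilon> < e" "L \<subseteq> K + cball 0 \<epsilon>"
proof -
  let ?S = "{\<epsilon>. 0 \<le> \<epsilon> \<and> K \<subseteq> L + cball 0 \<epsilon> \<and> L \<subseteq> K + cball 0 \<epsilon>}"
  have "bounded (K \<union> L)" using convex_bodiesD assms by simp
  then obtain R where R: "\<And>x y. x \<in> K \<union> L \<Longrightarrow> y \<in> K \<union> L \<Longrightarrow> dist x y \<le> R"
    unfolding bounded_two_points by meson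
  have sub: "A \<subseteq> B + cball 0 R" if AB: "A \<subseteq> K \<union> L" "B \<subseteq> K \<union> L" "B \<noteq> {}" for A B
  proof
    fix x assume "x \<in> A"
    obtain y where "y \<in> B" using AB by auto
    have "y + (x - y) \<in> B + cball 0 R"
      using \<open>y \<in> B\<close> \<open>x \<in> A\<close> AB R[of y x] by (intro set_plus_intro) (auto simp: dist_norm)
    then show "x \<in> B + cball 0 R" by simp
  qed
  obtain x where "x \<in> K" using convex_bodiesD assms by blast
  then have "0 \<le> R" using R[of x x] by simp
  then have "?S \<noteq> {}" using sub[of K L] sub[of L K] convex_bodiesD assms by blast
  then show thesis
    using cInf_lessD[of ?S e] assms(3) that unfolding hausdorff_dist_def by blast
qed

text \<open>Strict sublevel sets are open: \<open>L \<subseteq> K + cball 0 \<epsilon>\<close>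
  raises the support function by at most \<open>\<epsilon>\<close>, directions being unit
  vectors.\<close>

lemma measurable_support_fun:
  "(\<lambda>K. support_fun K \<phi>) \<in> borel_measurable convex_body_borel"
proof (rule borel_measurableI_less)
  fix a :: real
  let ?U = "{K \<in> convex_bodies. support_fun K \<phi> < a}"
  have "?U \<in> sets convex_body_borel"
  proof (rule sets_convex_body_borelI)
    fix K assume K: "K \<in> ?U"
    show "\<exists>e>0. \<forall>L\<in>convex_bodies. hausdorff_dist K L < e \<longrightarrow> L \<in> ?U"
    proof (intro exI conjI ballI impI)
      show "0 < a - support_fun K \<phi>" using K by simp
      fix L assume L: "L \<in> convex_bodies" "hausdorff_dist K L < a - support_fun K \<phi>"
      obtain \<epsilon> where \<epsilon>: "0 \<le> \<epsilon>" "\<epsilon> < a - support_fun K \<phi>" "L \<subseteq> K + cball 0 \<epsilon>"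
        using hausdorff_dist_lessE[OF _ L] K by auto
      have "y \<bullet> unit_vec \<phi> \<le> support_fun K \<phi> + \<epsilon>" if y: "y \<in> L" for y
      proof -
        obtain x b where x: "x \<in> K" "norm b \<le> \<epsilon>" "y = x + b"
          using y \<epsilon>(3) by (auto elim!: set_plus_elim dest!: subsetD)
        have "b \<bullet> unit_vec \<phi> \<le> \<epsilon>"
          using norm_cauchy_schwarz[of b "unit_vec \<phi>"] x(2) by simp
        then show ?thesis
          using inner_le_support_fun[of K x \<phi>] K x by (simp add: inner_add_left)
      qed
      then have "support_fun L \<phi> \<le> support_fun K \<phi> + \<epsilon>" by (rule support_fun_le[OF L(1)])
      then show "L \<in> ?U" using \<epsilon> L by simp
    qed
  qed simp
  then show "{K \<in> space convex_body_borel. support_fun K \<phi> < a} \<in> sets convex_body_borel" by simp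
qed

subsection \<open>Joint measurability of the radius of curvature\<close>

text \<open>On \<open>C2_plus\<close> the radius of curvature is \<open>h'' + h\<close>, \<open>h\<close> the support function; the limits
  of difference quotients make sense, and are measurable, for all bodies.\<close>

definition support_fun_deriv :: "(real^2) set \<Rightarrow> real \<Rightarrow> real" where
  "support_fun_deriv K \<phi> =
     lim (\<lambda>n. (support_fun K (\<phi> + 1 / real (Suc n)) - support_fun K \<phi>) * real (Suc n))"

definition support_fun_deriv2 :: "(real^2) set \<Rightarrow> real \<Rightarrow> real" where
  "support_fun_deriv2 K \<phi> =
     lim (\<lambda>n. (support_fun_deriv K (\<phi> + 1 / real (Suc n)) - support_fun_deriv K \<phi>) * real (Suc n))"

text \<open>The \<open>max 0\<close> changes nothing on \<open>C2_plus\<close>, where the radius is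
  positive. Elsewhere the limits may be arbitrary, and it secures the sign that a density
  requires.\<close>

definition curvature_radius :: "(real^2) set \<Rightarrow> real \<Rightarrow> real" where
  "curvature_radius K \<phi> = max 0 (support_fun_deriv2 K \<phi> + support_fun K \<phi>)"

lemma curvature_radius_nonneg [simp]: "0 \<le> curvature_radius K \<phi>"
  by (simp add: curvature_radius_def)

lemma curvature_radius_C2_plus:
  assumes K: "K \<in> C2_plus"
  shows "curvature_radius K \<phi> = radius_of_curvature K (unit_vec \<phi>)"
proof -
  have 1: "support_fun_deriv K \<phi> = support_point K \<phi> \<bullet> unit_tan \<phi>" for \<phi>
    unfolding support_fun_deriv_def support_fun_C2_plus[OF K]
    by (rule limI[OF has_real_derivative_imp_LIMSEQ[OF support_point_vec_has_derivative[OF K]]])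
  have "support_fun_deriv2 K \<phi> = radius_of_curvature K (unit_vec \<phi>) - support_point K \<phi> \<bullet> unit_vec \<phi>"
    unfolding support_fun_deriv2_def 1
    by (rule limI[OF has_real_derivative_imp_LIMSEQ[OF support_point_tan_has_derivative[OF K]]])
  then show ?thesis
    using radius_of_curvature_pos[OF K, of \<phi>] by (simp add: curvature_radius_def support_fun_C2_plus[OF K])
qed

context
  fixes Q :: "(real^2) set measure"
  assumes sets_Q: "sets Q = sets (restrict_space convex_body_borel centered_bodies)"
begin

lemma space_grains: "space Q \<subseteq> convex_bodies"
  using sets_eq_imp_space_eq[OF sets_Q] by (auto simp: space_restrict_space)

lemma measurable_support_fun_grains: "(\<lambda>K. support_fun K \<phi>) \<in> borel_measurable Q"
  using measurable_restrict_space1[OF measurable_support_fun] measurable_cong_sets[OF sets_Q refl] by blast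

text \<open>Measurable in the body and continuous in the angle: rounding the angle down to multiples
  of \<open>1 / real (Suc n)\<close> leaves countably many measurable pieces, and continuity gives
  the limit.\<close>

lemma measurable_support_fun_pair:
  "(\<lambda>z. support_fun (fst z) (snd z)) \<in> borel_measurable (Q \<Otimes>\<^sub>M borel)"
proof (rule borel_measurable_LIMSEQ_real)
  fix z assume "z \<in> space (Q \<Otimes>\<^sub>M (borel :: real measure))"
  then have K: "fst z \<in> convex_bodies" using space_grains by (auto simp: space_pair_measure)
  let ?a = "\<lambda>n. real_of_int \<lfloor>real (Suc n) * snd z\<rfloor> / real (Suc n)"
  have "?a \<longlonglongrightarrow> snd z"
  proof (rule tendsto_sandwich[OF always_eventually always_eventually _ tendsto_const])
    show "\<forall>n. snd z - inverse (real (Suc n)) \<le> ?a n"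
    proof
      fix n
      have "real (Suc n) * snd z - 1 \<le> real_of_int \<lfloor>real (Suc n) * snd z\<rfloor>" by linarith
      then have "(real (Suc n) * snd z - 1) / real (Suc n) \<le> ?a n" by (rule divide_right_mono) simp
      then show "snd z - inverse (real (Suc n)) \<le> ?a n"
        by (simp add: diff_divide_distrib inverse_eq_divide del: of_nat_Suc)
    qed
    show "\<forall>n. ?a n \<le> snd z"
    proof
      fix n
      have "?a n \<le> real (Suc n) * snd z / real (Suc n)" by (rule divide_right_mono) auto
      then show "?a n \<le> snd z" by (simp del: of_nat_Suc)
    qed
    have "(\<lambda>n. snd z - inverse (real (Suc n))) \<longlonglongrightarrow> snd z - 0"
      by (intro tendsto_intros LIMSEQ_inverse_real_of_nat)
    then show "(\<lambda>n. snd z - inverse (real (Suc n))) \<longlonglongrightarrow> snd z" by simp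
  qed
  moreover have "isCont (support_fun (fst z)) (snd z)"
    using continuous_on_support_fun[OF K] by (simp add: continuous_on_eq_continuous_at)
  ultimately show "(\<lambda>n. support_fun (fst z) (?a n)) \<longlonglongrightarrow> support_fun (fst z) (snd z)"
    by (rule isCont_tendsto_compose[rotated])
next
  fix n :: nat
  have "(\<lambda>z. support_fun (fst z) (real_of_int k / real (Suc n))) \<in> borel_measurable (Q \<Otimes>\<^sub>M borel)" for k
    by (rule measurable_compose[OF measurable_fst measurable_support_fun_grains])
  moreover have "(\<lambda>z. \<lfloor>real (Suc n) * snd z\<rfloor>) \<in> (Q \<Otimes>\<^sub>M borel) \<rightarrow>\<^sub>M count_space UNIV"
    by measurable
  ultimately show "(\<lambda>z. support_fun (fst z) (real_of_int \<lfloor>real (Suc n) * snd z\<rfloor> / real (Suc n)))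
      \<in> borel_measurable (Q \<Otimes>\<^sub>M borel)"
    by (rule measurable_compose_countable)
qed

lemma measurable_shift_pair:
  fixes f :: "(real^2) set \<Rightarrow> real \<Rightarrow> real"
  assumes "(\<lambda>z. f (fst z) (snd z)) \<in> borel_measurable (Q \<Otimes>\<^sub>M borel)"
  shows "(\<lambda>z. f (fst z) (snd z + c)) \<in> borel_measurable (Q \<Otimes>\<^sub>M borel)"
proof -
  have "(\<lambda>z. (fst z, snd z + c)) \<in> (Q \<Otimes>\<^sub>M borel) \<rightarrow>\<^sub>M (Q \<Otimes>\<^sub>M borel)" by measurable
  from measurable_compose[OF this assms] show ?thesis by simp
qed

lemma measurable_curvature_radius_pair:
  "(\<lambda>z. curvature_radius (fst z) (snd z)) \<in> borel_measurable (Q \<Otimes>\<^sub>M borel)"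
proof -
  note [measurable] = measurable_support_fun_pair measurable_shift_pair[OF measurable_support_fun_pair]
  have 1 [measurable]: "(\<lambda>z. support_fun_deriv (fst z) (snd z)) \<in> borel_measurable (Q \<Otimes>\<^sub>M borel)"
    unfolding support_fun_deriv_def by measurable
  note [measurable] = measurable_shift_pair[OF 1]
  have [measurable]: "(\<lambda>z. support_fun_deriv2 (fst z) (snd z)) \<in> borel_measurable (Q \<Otimes>\<^sub>M borel)"
    unfolding support_fun_deriv2_def by measurable
  show ?thesis unfolding curvature_radius_def by measurable
qed

end

subsection \<open>The mean radius of curvature as a density\<close>

text \<open>Serves the surface tensor, whose values are controlled only on \<open>C2_plus\<close>:
  the completion makes such an \<open>f\<close> measurable and preserves the integral of
  \<open>g\<close>.\<close>

lemma integral_completion_cong_AE: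
  fixes f g :: "'a \<Rightarrow> real"
  assumes g: "g \<in> borel_measurable M" and ae: "AE x in M. f x = g x"
  shows "integral\<^sup>L (completion M) f = integral\<^sup>L M g"
proof -
  have "f \<in> borel_measurable (completion M)"
  proof (rule measurableI)
    fix A :: "real set" assume "A \<in> sets borel"
    then have A: "g -` A \<inter> space M \<in> sets (completion M)"
      using measurable_sets[OF g] by simp
    have "AE x in completion M. x \<in> g -` A \<inter> space M \<longleftrightarrow> x \<in> f -` A \<inter> space M"
      using AE_completion[OF ae] by eventually_elim auto
    then show "f -` A \<inter> space (completion M) \<in> sets (completion M)"
      using completion.in_sets_AE[OF _ A] by simp
  qed simp
  then have "integral\<^sup>L (completion M) f = integral\<^sup>L (completion M) g"
    using measurable_completion[OF g] AE_completion[OF ae] by (intro integral_cong_AE)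
  then show ?thesis using integral_completion[OF g] by simp
qed

lemma sphere_surface_pos: "m > 0 \<Longrightarrow> sphere_surface m > 0"
  unfolding sphere_surface_def by (intro divide_pos_pos mult_pos_pos Gamma_real_pos) auto

text \<open>Defined through the product space so that both orders of integration are available:
  angle first gives the tensors, body first gives the density \<open>mean_radius\<close>.\<close>

definition radius_measure :: "real \<Rightarrow> (real^2) set measure \<Rightarrow> real measure" where
  "radius_measure \<gamma> Q = distr
     (density (Q \<Otimes>\<^sub>M lborel)
        (\<lambda>z. ennreal (\<gamma> * curvature_radius (fst z) (snd z) * indicator {0..<2*pi} (snd z))))
     borel snd"

context
  fixes \<gamma> :: real and Q :: "(real^2) set measure"
  assumes \<gamma>: "0 < \<gamma>" and Q: "grain_distribution Q" and AE_Q: "AE K in Q. K \<in> C2_plus"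
begin

lemma prob_space_Q: "prob_space Q"
  using Q by (simp add: grain_distribution_def)

lemma sets_Q: "sets Q = sets (restrict_space convex_body_borel centered_bodies)"
  using Q by (simp add: grain_distribution_def)

lemma pair_sigma_finite_Q: "pair_sigma_finite Q (lborel :: real measure)"
proof -
  interpret prob_space Q by (rule prob_space_Q)
  show ?thesis by unfold_locales
qed

lemma measurable_curvature_radius_pair_lborel:
  "(\<lambda>z. curvature_radius (fst z) (snd z)) \<in> borel_measurable (Q \<Otimes>\<^sub>M lborel)"
  using measurable_curvature_radius_pair[OF sets_Q]
    measurable_cong_sets[OF sets_pair_measure_cong[OF refl sets_lborel] refl] by blast

lemma measurable_radius_weight:
  "(\<lambda>z. \<gamma> * curvature_radius (fst z) (snd z) * indicator {0..<2*pi} (snd z))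
     \<in> borel_measurable (Q \<Otimes>\<^sub>M lborel)"
proof -
  note [measurable] = measurable_curvature_radius_pair_lborel
  show ?thesis by measurable
qed

lemma emeasure_radius_measure:
  assumes [measurable]: "A \<in> sets borel"
  shows "emeasure (radius_measure \<gamma> Q) A =
     (\<integral>\<^sup>+z. ennreal (\<gamma> * curvature_radius (fst z) (snd z) * indicator {0..<2*pi} (snd z)) *
        indicator A (snd z) \<partial>(Q \<Otimes>\<^sub>M lborel))"
proof -
  have [measurable]: "(\<lambda>z. ennreal (\<gamma> * curvature_radius (fst z) (snd z) * indicator {0..<2*pi} (snd z)))
     \<in> borel_measurable (Q \<Otimes>\<^sub>M lborel)"
    by (rule measurable_compose[OF measurable_radius_weight measurable_ennreal])
  have "snd -` A \<inter> space (Q \<Otimes>\<^sub>M lborel) \<in> sets (Q \<Otimes>\<^sub>M (lborel :: real measure))"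
    by measurable
  then have "emeasure (radius_measure \<gamma> Q) A =
     (\<integral>\<^sup>+z. ennreal (\<gamma> * curvature_radius (fst z) (snd z) * indicator {0..<2*pi} (snd z)) *
        indicator (snd -` A \<inter> space (Q \<Otimes>\<^sub>M lborel)) z \<partial>(Q \<Otimes>\<^sub>M lborel))"
    unfolding radius_measure_def by (subst emeasure_distr, measurable) (simp only: space_density, subst emeasure_density, measurable)
  also have "\<dots> = (\<integral>\<^sup>+z. ennreal (\<gamma> * curvature_radius (fst z) (snd z) * indicator {0..<2*pi} (snd z)) *
        indicator A (snd z) \<partial>(Q \<Otimes>\<^sub>M lborel))"
    by (intro nn_integral_cong) (auto split: split_indicator)
  finally show ?thesis .
qed

lemma mean_radius_eq:
  "mean_radius \<gamma> Q (unit_vec \<phi>) = ennreal \<gamma> * (\<integral>\<^sup>+K. ennreal (curvature_radius K \<phi>) \<partial>Q)"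
  unfolding mean_radius_def using AE_Q
  by (intro arg_cong2[where f="(*)"] refl nn_integral_cong_AE)
     (auto elim!: eventually_mono simp: curvature_radius_C2_plus)

lemma measurable_curvature_radius_snd:
  "(\<lambda>K. curvature_radius K \<phi>) \<in> borel_measurable Q"
proof -
  have "(\<lambda>K. (K, \<phi>)) \<in> Q \<rightarrow>\<^sub>M Q \<Otimes>\<^sub>M lborel" by measurable
  from measurable_compose[OF this measurable_curvature_radius_pair_lborel] show ?thesis by simp
qed

lemma measurable_mean_radius: "(\<lambda>\<phi>. mean_radius \<gamma> Q (unit_vec \<phi>)) \<in> borel_measurable borel"
proof -
  interpret prob_space Q by (rule prob_space_Q)
  have "(\<lambda>z. (snd z, fst z)) \<in> borel \<Otimes>\<^sub>M Q \<rightarrow>\<^sub>M Q \<Otimes>\<^sub>M borel" by measurable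
  from measurable_compose[OF this measurable_curvature_radius_pair[OF sets_Q]]
  have [measurable]: "(\<lambda>z. curvature_radius (snd z) (fst z)) \<in> borel_measurable (borel \<Otimes>\<^sub>M Q)" by simp
  have "(\<lambda>\<phi>. \<integral>\<^sup>+K. ennreal (curvature_radius K \<phi>) \<partial>Q) \<in> borel_measurable borel"
    by (rule borel_measurable_nn_integral) (simp add: split_beta')
  then show ?thesis unfolding mean_radius_eq by measurable
qed

text \<open>Tonelli with the body integrated first, valid also at angles where the mean radius is
  infinite.\<close>

lemma radius_measure_eq_density:
  "radius_measure \<gamma> Q = density lborel (\<lambda>\<phi>. mean_radius \<gamma> Q (unit_vec \<phi>) * indicator {0..<2*pi} \<phi>)"
proof (rule measure_eqI)
  interpret pair_sigma_finite Q "lborel :: real measure" by (rule pair_sigma_finite_Q)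
  note [measurable] = measurable_curvature_radius_pair_lborel measurable_radius_weight
    measurable_mean_radius measurable_curvature_radius_snd
  fix A assume "A \<in> sets (radius_measure \<gamma> Q)"
  then have [measurable]: "A \<in> sets borel" by (simp add: radius_measure_def)
  have "emeasure (radius_measure \<gamma> Q) A =
     (\<integral>\<^sup>+z. ennreal (\<gamma> * curvature_radius (fst z) (snd z) * indicator {0..<2*pi} (snd z)) *
        indicator A (snd z) \<partial>(Q \<Otimes>\<^sub>M lborel))"
    by (rule emeasure_radius_measure) measurable
  also have "\<dots> = (\<integral>\<^sup>+\<phi>. \<integral>\<^sup>+K. ennreal (\<gamma> * curvature_radius K \<phi> * indicator {0..<2*pi} \<phi>) *
        indicator A \<phi> \<partial>Q \<partial>lborel)"
    by (subst nn_integral_snd[symmetric]) auto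
  also have "\<dots> = (\<integral>\<^sup>+\<phi>. mean_radius \<gamma> Q (unit_vec \<phi>) * indicator {0..<2*pi} \<phi> * indicator A \<phi> \<partial>lborel)"
  proof (rule nn_integral_cong)
    fix \<phi> :: real
    have "(\<integral>\<^sup>+K. ennreal (\<gamma> * curvature_radius K \<phi> * indicator {0..<2*pi} \<phi>) * indicator A \<phi> \<partial>Q) =
      (\<integral>\<^sup>+K. ennreal \<gamma> * ennreal (curvature_radius K \<phi>) * (indicator {0..<2*pi} \<phi> * indicator A \<phi>) \<partial>Q)"
      using \<gamma> by (intro nn_integral_cong) (auto simp: ennreal_mult split: split_indicator)
    also have "\<dots> = mean_radius \<gamma> Q (unit_vec \<phi>) * (indicator {0..<2*pi} \<phi> * indicator A \<phi>)"
      by (subst nn_integral_multc, measurable, subst nn_integral_cmult, measurable)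
         (simp add: mean_radius_eq)
    finally show "(\<integral>\<^sup>+K. ennreal (\<gamma> * curvature_radius K \<phi> * indicator {0..<2*pi} \<phi>) * indicator A \<phi> \<partial>Q) =
      mean_radius \<gamma> Q (unit_vec \<phi>) * indicator {0..<2*pi} \<phi> * indicator A \<phi>"
      by (simp add: mult.assoc)
  qed
  also have "\<dots> = emeasure (density lborel (\<lambda>\<phi>. mean_radius \<gamma> Q (unit_vec \<phi>) * indicator {0..<2*pi} \<phi>)) A"
    by (subst emeasure_density) auto
  finally show "emeasure (radius_measure \<gamma> Q) A =
      emeasure (density lborel (\<lambda>\<phi>. mean_radius \<gamma> Q (unit_vec \<phi>) * indicator {0..<2*pi} \<phi>)) A" .
qed (simp add: radius_measure_def)

lemma sets_radius_measure: "sets (radius_measure \<gamma> Q) = sets borel"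
  by (simp add: radius_measure_def)

lemma AE_radius_measure: "AE \<phi> in radius_measure \<gamma> Q. \<phi> \<in> {0..<2*pi}"
proof -
  note [measurable] = measurable_mean_radius
  show ?thesis
    unfolding radius_measure_eq_density by (subst AE_density) (auto split: split_indicator)
qed

text \<open>Tonelli with the angle integrated first: the inner integral is almost surely at most the
  area of the unit parallel body, whose mean is finite for a grain distribution.\<close>

lemma finite_radius_measure: "finite_measure (radius_measure \<gamma> Q)"
proof (rule finite_measureI)
  interpret pair_sigma_finite Q "lborel :: real measure" by (rule pair_sigma_finite_Q)
  note [measurable] = measurable_curvature_radius_pair_lborel measurable_radius_weight
  have g [measurable]: "(\<lambda>K. \<integral>\<^sup>+\<phi>. ennreal (curvature_radius K \<phi>) * indicator {0..<2*pi} \<phi> \<partial>lborel) \<in> borel_measurable Q"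
    by (rule lborel.borel_measurable_nn_integral) (simp add: split_beta')
  have "emeasure (radius_measure \<gamma> Q) (space (radius_measure \<gamma> Q)) =
    (\<integral>\<^sup>+z. ennreal \<gamma> * (ennreal (curvature_radius (fst z) (snd z)) * indicator {0..<2*pi} (snd z)) \<partial>(Q \<Otimes>\<^sub>M lborel))"
    using \<gamma> sets_eq_imp_space_eq[OF sets_radius_measure]
    by (auto simp: emeasure_radius_measure ennreal_mult intro!: nn_integral_cong split: split_indicator)
  also have "\<dots> = (\<integral>\<^sup>+K. \<integral>\<^sup>+\<phi>. ennreal \<gamma> * (ennreal (curvature_radius K \<phi>) * indicator {0..<2*pi} \<phi>) \<partial>lborel \<partial>Q)"
    by (subst lborel.nn_integral_fst[symmetric]) auto
  also have "\<dots> = (\<integral>\<^sup>+K. ennreal \<gamma> * (\<integral>\<^sup>+\<phi>. ennreal (curvature_radius K \<phi>) * indicator {0..<2*pi} \<phi> \<partial>lborel) \<partial>Q)"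
  proof (intro nn_integral_cong nn_integral_cmult)
    fix K assume "K \<in> space Q"
    then have "(\<lambda>\<phi>. (K, \<phi>)) \<in> borel \<rightarrow>\<^sub>M Q \<Otimes>\<^sub>M lborel" by measurable
    from measurable_compose[OF this measurable_curvature_radius_pair_lborel]
    have [measurable]: "curvature_radius K \<in> borel_measurable borel" by simp
    show "(\<lambda>\<phi>. ennreal (curvature_radius K \<phi>) * indicator {0..<2*pi} \<phi>) \<in> borel_measurable lborel"
      by measurable
  qed
  also have "\<dots> = ennreal \<gamma> * (\<integral>\<^sup>+K. \<integral>\<^sup>+\<phi>. ennreal (curvature_radius K \<phi>) * indicator {0..<2*pi} \<phi> \<partial>lborel \<partial>Q)"
    by (rule nn_integral_cmult[OF g])
  also have "\<dots> \<le> ennreal \<gamma> * (\<integral>\<^sup>+K. emeasure lborel (K + cball 0 1) \<partial>Q)"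
  proof (intro mult_left_mono nn_integral_mono_AE)
    show "AE K in Q. (\<integral>\<^sup>+\<phi>. ennreal (curvature_radius K \<phi>) * indicator {0..<2*pi} \<phi> \<partial>lborel)
        \<le> emeasure lborel (K + cball 0 1)"
      using AE_Q by eventually_elim
        (simp only: curvature_radius_C2_plus nn_integral_radius_of_curvature_le)
  qed simp
  also have "\<dots> < \<infinity>"
    using Q by (simp add: grain_distribution_def ennreal_mult_less_top)
  finally show "emeasure (radius_measure \<gamma> Q) (space (radius_measure \<gamma> Q)) \<noteq> \<infinity>" by simp
qed

text \<open>Fubini with the angle integrated first. The extra \<open>/ 2\<close> is that of the
  support measure density \<open>r / 2\<close>; the intensity is already contained in
  \<open>radius_measure\<close>.\<close>

lemma surface_tensor_density_eq:
  "surface_tensor_density \<gamma> Q (length is) is =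
    1 / fact (length is) * (sphere_surface 1 / sphere_surface (1 + length is)) / 2 *
    (\<integral>\<phi>. (\<Prod>i\<leftarrow>is. unit_vec \<phi> $ i) \<partial>radius_measure \<gamma> Q)"
proof -
  interpret pair_sigma_finite Q "lborel :: real measure" by (rule pair_sigma_finite_Q)
  note [measurable] = measurable_curvature_radius_pair_lborel measurable_radius_weight
  define C where "C = 1 / fact (length is) * (sphere_surface 1 / sphere_surface (1 + length is))"
  define T where "T \<phi> = (\<Prod>i\<leftarrow>is. unit_vec \<phi> $ i)" for \<phi>
  have T [measurable]: "T \<in> borel_measurable borel"
    unfolding T_def[abs_def] by (intro borel_measurable_continuous_onI continuous_intros)
  let ?w = "\<lambda>K \<phi>. \<gamma> * curvature_radius K \<phi> * indicator {0..<2*pi} \<phi>"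
  have snd_m: "snd \<in> density (Q \<Otimes>\<^sub>M lborel) (\<lambda>z. ennreal (?w (fst z) (snd z))) \<rightarrow>\<^sub>M (borel :: real measure)"
    by measurable
  have w: "0 \<le> ?w K \<phi>" for K \<phi> using \<gamma> by simp
  \<comment> \<open>Monomials are bounded on the circle and the measure is finite; pulled back to
    the product space, this supplies the integrability for Fubini.\<close>
  have "integrable (radius_measure \<gamma> Q) T"
    unfolding T_def[abs_def]
    by (rule integrable_continuous_unit_vec[OF finite_radius_measure sets_radius_measure,
          of "\<lambda>x. \<Prod>i\<leftarrow>is. x $ i"]) (intro continuous_intros)
  then have "integrable (density (Q \<Otimes>\<^sub>M lborel) (\<lambda>z. ennreal (?w (fst z) (snd z)))) (\<lambda>z. T (snd z))"
    unfolding radius_measure_def integrable_distr_eq[OF snd_m T] .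
  then have int: "integrable (Q \<Otimes>\<^sub>M lborel) (\<lambda>z. ?w (fst z) (snd z) *\<^sub>R T (snd z))"
    using w by (subst (asm) integrable_density) auto
  have "(\<integral>\<phi>. T \<phi> \<partial>radius_measure \<gamma> Q) =
      (\<integral>z. T (snd z) \<partial>density (Q \<Otimes>\<^sub>M lborel) (\<lambda>z. ennreal (?w (fst z) (snd z))))"
    unfolding radius_measure_def by (rule integral_distr[OF snd_m T])
  also have "\<dots> = (\<integral>z. ?w (fst z) (snd z) *\<^sub>R T (snd z) \<partial>(Q \<Otimes>\<^sub>M lborel))"
    using w by (intro integral_density) auto
  also have "\<dots> = (\<integral>K. \<integral>\<phi>. ?w K \<phi> *\<^sub>R T \<phi> \<partial>lborel \<partial>Q)"
    using integral_fst'[OF int] by simp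
  finally have I: "(\<integral>\<phi>. T \<phi> \<partial>radius_measure \<gamma> Q) = (\<integral>K. \<integral>\<phi>. ?w K \<phi> *\<^sub>R T \<phi> \<partial>lborel \<partial>Q)" .
  \<comment> \<open>The weight \<open>?w\<close> carries \<open>\<gamma>\<close> and the full
    radius, the support measure half of the radius, hence \<open>2 * \<gamma>\<close> in the
    denominator.\<close>
  have st: "surface_tensor (length is) K is = C / (2 * \<gamma>) * (\<integral>\<phi>. ?w K \<phi> *\<^sub>R T \<phi> \<partial>lborel)"
    if K: "K \<in> C2_plus" for K
  proof -
    have "?w K \<phi> *\<^sub>R T \<phi> = (2 * \<gamma>) *
       ((radius_of_curvature K (unit_vec \<phi>) / 2 * indicator {0..<2*pi} \<phi>) * T \<phi>)" for \<phi>
      by (simp add: curvature_radius_C2_plus[OF K])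
    then have "(\<integral>\<phi>. ?w K \<phi> *\<^sub>R T \<phi> \<partial>lborel) =
       (2 * \<gamma>) * (\<integral>\<phi>. (radius_of_curvature K (unit_vec \<phi>) / 2 * indicator {0..<2*pi} \<phi>) * T \<phi> \<partial>lborel)"
      by (simp only: integral_mult_right_zero)
    then show ?thesis
      using \<gamma> unfolding surface_tensor_C2_plus[OF K] C_def[symmetric] T_def[symmetric] by simp
  qed
  have "surface_tensor_density \<gamma> Q (length is) is =
     \<gamma> * (\<integral>K. C / (2 * \<gamma>) * (\<integral>\<phi>. ?w K \<phi> *\<^sub>R T \<phi> \<partial>lborel) \<partial>Q)"
    unfolding surface_tensor_density_def
  proof (rule arg_cong[where f="(*) \<gamma>"], rule integral_completion_cong_AE)
    have "(\<lambda>(K, \<phi>). ?w K \<phi> *\<^sub>R T \<phi>) \<in> borel_measurable (Q \<Otimes>\<^sub>M lborel)"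
      using borel_measurable_integrable[OF int] by (simp add: split_beta')
    then have "(\<lambda>K. \<integral>\<phi>. ?w K \<phi> *\<^sub>R T \<phi> \<partial>lborel) \<in> borel_measurable Q"
      by (rule lborel.borel_measurable_lebesgue_integral)
    then show "(\<lambda>K. C / (2 * \<gamma>) * (\<integral>\<phi>. ?w K \<phi> *\<^sub>R T \<phi> \<partial>lborel)) \<in> borel_measurable Q"
      by (intro borel_measurable_times borel_measurable_const)
    show "AE K in Q. surface_tensor (length is) K is = C / (2 * \<gamma>) * (\<integral>\<phi>. ?w K \<phi> *\<^sub>R T \<phi> \<partial>lborel)"
      using AE_Q by eventually_elim (rule st)
  qed
  also have "\<dots> = \<gamma> * (C / (2 * \<gamma>) * (\<integral>\<phi>. T \<phi> \<partial>radius_measure \<gamma> Q))"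
    unfolding I by (simp only: integral_mult_right_zero)
  also have "\<dots> = C / 2 * (\<integral>\<phi>. T \<phi> \<partial>radius_measure \<gamma> Q)"
    using \<gamma> by simp
  finally show ?thesis by (simp only: C_def T_def)
qed

end

theorem mainTheorem8:
  fixes \<gamma> \<gamma>' :: real
    and Q Q' :: "(real^2) set measure"
    and M :: "'w measure" and M' :: "'v measure"
    and X :: "'w \<Rightarrow> (real^2) set set" and X' :: "'v \<Rightarrow> (real^2) set set"
  assumes "0 < \<gamma>" and "0 < \<gamma>'"
    and "grain_distribution Q" and "grain_distribution Q'"
    and "AE K in Q. K \<in> C2_plus" and "AE K in Q'. K \<in> C2_plus"
    and "poisson_particle_process M X \<gamma> Q" and "poisson_particle_process M' X' \<gamma>' Q'"
    and "\<And>s. surface_tensor_density \<gamma> Q s = surface_tensor_density \<gamma>' Q' s"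
  shows "AE \<phi> in lborel. \<phi> \<in> {0..2*pi} \<longrightarrow>
           mean_radius \<gamma> Q (unit_vec \<phi>) = mean_radius \<gamma>' Q' (unit_vec \<phi>)"
proof -
  note A = assms(1,3,5) and A' = assms(2,4,6)
  note [measurable] = measurable_mean_radius[OF A] measurable_mean_radius[OF A']
  have "(\<integral>\<phi>. (\<Prod>i\<leftarrow>is. unit_vec \<phi> $ i) \<partial>radius_measure \<gamma> Q) =
      (\<integral>\<phi>. (\<Prod>i\<leftarrow>is. unit_vec \<phi> $ i) \<partial>radius_measure \<gamma>' Q')" for "is"
  proof -
    \<comment> \<open>The moment with index list \<open>is\<close> is read off the density of rank
      \<open>length is\<close>; its factor is positive and can be cancelled.\<close>
    have "1 / fact (length is) * (sphere_surface 1 / sphere_surface (1 + length is)) / 2 > 0"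
      by (intro divide_pos_pos mult_pos_pos sphere_surface_pos) auto
    then show ?thesis
      using fun_cong[OF assms(9)[of "length is"], of "is"]
      unfolding surface_tensor_density_eq[OF A] surface_tensor_density_eq[OF A']
      by (metis less_irrefl mult_left_cancel)
  qed
  then have "radius_measure \<gamma> Q = radius_measure \<gamma>' Q'"
    by (intro circle_measure_eq_of_moments finite_radius_measure[OF A] finite_radius_measure[OF A']
        sets_radius_measure[OF A] sets_radius_measure[OF A'] AE_radius_measure[OF A] AE_radius_measure[OF A'])
  \<comment> \<open>Equal measures have almost everywhere equal densities with respect to the
    sigma-finite Lebesgue measure, even for densities with values in \<open>ennreal\<close>.\<close>
  then have "AE \<phi> in lborel. mean_radius \<gamma> Q (unit_vec \<phi>) * indicator {0..<2*pi} \<phi> =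
      mean_radius \<gamma>' Q' (unit_vec \<phi>) * indicator {0..<2*pi} \<phi>"
    unfolding radius_measure_eq_density[OF A] radius_measure_eq_density[OF A']
    by (intro sigma_finite_measure.density_unique[OF sigma_finite_lborel]) auto
  \<comment> \<open>The measures live on \<open>{0..<2*pi}\<close>; the remaining endpoint of the
    closed interval is a null set.\<close>
  with AE_lborel_singleton[of "2*pi"] show ?thesis
    by eventually_elim (auto split: split_indicator_asm)
qed

end
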